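(* Let $X, Y$ be Polish spaces equipped with Borel probability measures $\mu$ and $\nu$, and let $c: X\times Y\to[0,\infty]$ be Borel measurable. Then $P^{\mathrm{rel}} = D$ (where both sides may equal $+\infty$).
   Context: For $0\le\varepsilon\le1$, let $\Pi^{\varepsilon}(\mu,\nu)$ be the set of non-negative Borel measures $\pi$ on $X\times Y$ with total mass $\pi(X\times Y)\ge 1-\varepsilon$ whose marginals satisfy $p_X(\pi)\le\mu$ and $p_Y(\pi)\le\nu$. Here $p_X(\pi)$ and $p_Y(\pi)$ denote the projections (marginals) of $\pi$ onto $X$ and $Y$, and $\le$ is the setwise order of measures. Set $P^{\varepsilon}=\inf\{\int_{X\times Y} c\,d\pi : \pi\in\Pi^{\varepsilon}(\mu,\nu)\}$ and $P^{\mathrm{rel}}=\lim_{\varepsilon\to0}P^{\varepsilon}$ (a limit in $[0,\infty]$). Let $\Psi(\mu,\nu)$ be the set of pairs $(\varphi,\psi)$ with $\varphi:X\to[-\infty,\infty)$ $\mu$-integrable and $\psi:Y\to[-\infty,\infty)$ $\nu$-integrable such that $\varphi(x)+\psi(y)\le c(x,y)$ for all $(x,y)\in X\times Y$. Set $D=\sup\{\int_X\varphi\,d\mu+\int_Y\psi\,d\nu : (\varphi,\psi)\in\Psi(\mu,\nu)\}$. *)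

theory Defs
  imports "HOL-Probability.Probability"
begin

definition partial_couplings ::
  "'a::polish_space measure \<Rightarrow> 'b::polish_space measure \<Rightarrow> real \<Rightarrow> ('a \<times> 'b) measure set" where
  "partial_couplings \<mu> \<nu> \<epsilon> =
     {\<pi>. sets \<pi> = sets (borel :: ('a \<times> 'b) measure) \<and>
          emeasure \<pi> (space \<pi>) \<ge> ennreal (1 - \<epsilon>) \<and>
          (\<forall>A \<in> sets (borel :: 'a measure). emeasure (distr \<pi> borel fst) A \<le> emeasure \<mu> A) \<and>
          (\<forall>B \<in> sets (borel :: 'b measure). emeasure (distr \<pi> borel snd) B \<le> emeasure \<nu> B)}"

definition P_eps ::
  "'a::polish_space measure \<Rightarrow> 'b::polish_space measure \<Rightarrow> ('a \<times> 'b \<Rightarrow> ennreal) \<Rightarrow> real \<Rightarrow> ennreal" where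
  "P_eps \<mu> \<nu> c \<epsilon> = (INF \<pi> \<in> partial_couplings \<mu> \<nu> \<epsilon>. \<integral>\<^sup>+ z. c z \<partial>\<pi>)"

text \<open>Integrability of a function with values in [-\<infinity>, \<infinity>): measurable, never +\<infinity>,
  and with finite integral of the absolute value; its integral is the Lebesgue integral of
  the (a.e. finite) real part.\<close>
definition ereal_integrable :: "'a measure \<Rightarrow> ('a \<Rightarrow> ereal) \<Rightarrow> bool" where
  "ereal_integrable M f \<longleftrightarrow> f \<in> borel_measurable M \<and> (\<forall>x \<in> space M. f x < \<infinity>) \<and>
     (\<integral>\<^sup>+ x. e2ennreal \<bar>f x\<bar> \<partial>M) < \<infinity>"

definition ereal_integral :: "'a measure \<Rightarrow> ('a \<Rightarrow> ereal) \<Rightarrow> real" where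
  "ereal_integral M f = (\<integral> x. real_of_ereal (f x) \<partial>M)"

definition dual_pairs ::
  "'a measure \<Rightarrow> 'b measure \<Rightarrow> ('a \<times> 'b \<Rightarrow> ennreal) \<Rightarrow> (('a \<Rightarrow> ereal) \<times> ('b \<Rightarrow> ereal)) set" where
  "dual_pairs \<mu> \<nu> c =
     {(\<phi>, \<psi>). ereal_integrable \<mu> \<phi> \<and> ereal_integrable \<nu> \<psi> \<and>
        (\<forall>x y. \<phi> x + \<psi> y \<le> enn2ereal (c (x, y)))}"

definition D_dual ::
  "'a measure \<Rightarrow> 'b measure \<Rightarrow> ('a \<times> 'b \<Rightarrow> ennreal) \<Rightarrow> ereal" where
  "D_dual \<mu> \<nu> c = (SUP p \<in> dual_pairs \<mu> \<nu> c.
      ereal (ereal_integral \<mu> (fst p) + ereal_integral \<nu> (snd p)))"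

end

theory Submission
  imports Defs
begin

text \<open>
  For bounded gains \<open>h\<close> with values in \<open>[0,1]\<close> one compares the supremum of \<open>\<integral>h d\<pi>\<close> over measures
  \<open>\<pi>\<close> with marginals dominated by \<open>\<mu>\<close> and \<open>\<nu>\<close> with the infimum of \<open>\<integral>\<phi> d\<mu> + \<integral>\<psi> d\<nu>\<close> over
  \<open>\<phi>(x) + \<psi>(y) \<ge> h(x,y)\<close>. Polish spaces are Borel retracts of the real line, so both spaces may be
  taken to be \<open>[0,1]\<close>. The covering value of the hypograph of \<open>h\<close>, a Borel subset of \<open>[0,1]\<^sup>3\<close>, is a
  Choquet capacity: continuity along increasing sequences comes from almost norm-minimal elements of
  convex sets in \<open>L\<^sup>2\<close>. Hence the hypograph may be replaced by a decreasing sequence of compact sets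
  with the same covering value and with intersection inside it. On grids of mesh \<open>1/N\<close> the duality is
  finite-dimensional (optimality conditions of a quadratic penalty), and a weak limit of the discrete
  plans is carried by the hypograph.

  A cost \<open>c\<close> with dual value \<open>D\<close> enters through \<open>h = (1 - c/M)\<^sup>+\<close>: a plan nearly optimal for \<open>h\<close>,
  restricted to \<open>{c < M}\<close>, has cost at most \<open>D + \<delta>\<close> and loses mass at most \<open>(D + \<delta>)/M\<close>, which is
  exactly the slack that the relaxed problem allows. For the converse inequality dual potentials are
  truncated at a level \<open>n\<close>, so that a mass defect \<open>\<epsilon>\<close> costs at most \<open>2n\<epsilon>\<close>.
\<close>

subsection \<open>Finite transport problems\<close>

text \<open>Replacing the constraint \<open>h i j \<le> a i + b j\<close> by a quadratic penalty
  gives a continuous function on a compact box, hence a minimiser. The positive parts of the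
  violations, divided by \<open>\<epsilon>\<close>, form the plan; stationarity in each coordinate
  yields the marginal bounds and complementary slackness.\<close>

lemma finite_transport_penalty:
  fixes m n :: "nat \<Rightarrow> real" and h :: "nat \<Rightarrow> nat \<Rightarrow> real"
  assumes fin: "finite I" "finite J" and m: "\<And>i. 0 \<le> m i" and n: "\<And>j. 0 \<le> n j"
    and h: "\<And>i j. 0 \<le> h i j" "\<And>i j. h i j \<le> 1" and \<epsilon>: "0 < \<epsilon>"
  obtains a b p where "\<And>i. 0 \<le> a i" "\<And>i. a i \<le> 1" "\<And>j. 0 \<le> b j" "\<And>j. b j \<le> 1" "\<And>i j. 0 \<le> p i j"
    "\<And>i. i \<in> I \<Longrightarrow> (\<Sum>j\<in>J. p i j) \<le> m i" "\<And>j. j \<in> J \<Longrightarrow> (\<Sum>i\<in>I. p i j) \<le> n j"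
    "\<And>i j. h i j \<le> a i + b j + \<epsilon> * p i j"
    "(\<Sum>i\<in>I. a i * m i) + (\<Sum>j\<in>J. b j * n j) \<le> (\<Sum>i\<in>I. \<Sum>j\<in>J. h i j * p i j)"
proof -
  define q where "q a b i j = max 0 (h i j - a i - b j)" for a b :: "nat \<Rightarrow> real" and i j
  define F where "F z = (\<Sum>i\<in>I. fst z i * m i) + (\<Sum>j\<in>J. snd z j * n j)
    + (\<Sum>i\<in>I. \<Sum>j\<in>J. (q (fst z) (snd z) i j)\<^sup>2) / (2 * \<epsilon>)" for z
  \<comment> \<open>A product over all of \<open>nat\<close>, compact by Tychonoff's
    theorem.\<close>
  define B where "B = (PiE UNIV (\<lambda>_. {0..1}) :: (nat \<Rightarrow> real) set)"
  have "compactin (product_topology (\<lambda>i. euclidean) UNIV) B"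
    unfolding B_def compactin_PiE by auto
  then have "compact B" by (simp add: euclidean_product_topology)
  then have cB: "compact (B \<times> B)" by (intro compact_Times)
  have coord: "continuous_on UNIV (\<lambda>z::(nat \<Rightarrow> real) \<times> (nat \<Rightarrow> real). fst z i)"
    "continuous_on UNIV (\<lambda>z::(nat \<Rightarrow> real) \<times> (nat \<Rightarrow> real). snd z i)" for i
    by (rule continuous_on_product_then_coordinatewise, intro continuous_intros)+
  have "continuous_on UNIV F"
    unfolding F_def q_def using \<epsilon> by (intro continuous_intros coord) auto
  then have "continuous_on (B \<times> B) F" by (rule continuous_on_subset) auto
  moreover have "B \<times> B \<noteq> {}" by (auto simp: B_def PiE_eq_empty_iff)
  ultimately obtain z where z: "z \<in> B \<times> B" "\<And>w. w \<in> B \<times> B \<Longrightarrow> F z \<le> F w"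
    using continuous_attains_inf[OF cB] by blast
  define a b where "a = fst z" and "b = snd z"
  have ab: "0 \<le> a i" "a i \<le> 1" "0 \<le> b i" "b i \<le> 1" for i
    using z(1) by (auto simp: a_def b_def B_def PiE_iff mem_Times_iff)
  \<comment> \<open>The derivative of the penalty term with respect to \<open>h i j\<close>, that
    is, the multiplier of the covering constraint at \<open>(i, j)\<close>.\<close>
  define p where "p i j = q a b i j / \<epsilon>" for i j
  have p0: "0 \<le> p i j" for i j using \<epsilon> by (auto simp: p_def q_def)
  \<comment> \<open>A one-sided second-order expansion of the squared positive part, valid for
    \<open>d\<close> of either sign; it stands in for differentiation.\<close>
  have sq: "(max 0 (c - d))\<^sup>2 \<le> (max 0 c)\<^sup>2 - 2 * d * max 0 c + d\<^sup>2" for c d :: real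
  proof -
    have "(max 0 (c - d))\<^sup>2 \<le> (max 0 c - d)\<^sup>2"
      by (rule abs_le_square_iff[THEN iffD1]) (auto simp: max_def)
    also have "\<dots> = (max 0 c)\<^sup>2 - 2 * d * max 0 c + d\<^sup>2" by (simp add: power2_eq_square algebra_simps)
    finally show ?thesis .
  qed
  \<comment> \<open>First-order optimality in one variable, kept as a quadratic inequality in the increment.\<close>
  have vara: "0 \<le> d * (m k - (\<Sum>j\<in>J. p k j)) + card J * d\<^sup>2 / (2 * \<epsilon>)"
    if k: "k \<in> I" and d: "0 \<le> a k + d" "a k + d \<le> 1" for k and d :: real
  proof -
    define a' where "a' = a(k := a k + d)"
    have "(a', b) \<in> B \<times> B" using ab d by (auto simp: a'_def B_def PiE_iff)
    then have "F z \<le> F (a', b)" by (rule z(2))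
    moreover have "(\<Sum>i\<in>I. a' i * m i) = (\<Sum>i\<in>I. a i * m i) + d * m k"
      using k fin by (simp add: a'_def sum.remove algebra_simps)
    moreover have "(\<Sum>i\<in>I. \<Sum>j\<in>J. (q a' b i j)\<^sup>2) \<le> (\<Sum>i\<in>I. \<Sum>j\<in>J. (q a b i j)\<^sup>2)
        - 2 * (d * \<epsilon>) * (\<Sum>j\<in>J. p k j) + card J * d\<^sup>2"
    proof -
      have "(\<Sum>j\<in>J. (q a' b k j)\<^sup>2) \<le> (\<Sum>j\<in>J. (q a b k j)\<^sup>2 - 2 * d * q a b k j + d\<^sup>2)"
        using sq[of "h k _ - a k - b _" d]
        by (intro sum_mono) (simp add: q_def a'_def algebra_simps)
      also have "\<dots> = (\<Sum>j\<in>J. (q a b k j)\<^sup>2) - 2 * (d * \<epsilon>) * (\<Sum>j\<in>J. p k j) + card J * d\<^sup>2"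
        using \<epsilon> by (simp add: sum.distrib sum_subtractf sum_distrib_left p_def mult.assoc)
      finally have 1: "(\<Sum>j\<in>J. (q a' b k j)\<^sup>2) \<le> \<dots>" .
      have "(\<Sum>i\<in>I - {k}. \<Sum>j\<in>J. (q a' b i j)\<^sup>2) = (\<Sum>i\<in>I - {k}. \<Sum>j\<in>J. (q a b i j)\<^sup>2)"
        by (intro sum.cong) (auto simp: q_def a'_def)
      with 1 show ?thesis using k fin by (simp add: sum.remove[of I k])
    qed
    moreover from this have "(\<Sum>i\<in>I. \<Sum>j\<in>J. (q a' b i j)\<^sup>2) / (2 * \<epsilon>) \<le> (\<Sum>i\<in>I. \<Sum>j\<in>J. (q a b i j)\<^sup>2) / (2 * \<epsilon>)
        + (- 2 * (d * \<epsilon>) * (\<Sum>j\<in>J. p k j) + card J * d\<^sup>2) / (2 * \<epsilon>)"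
      unfolding add_divide_distrib[symmetric] using \<epsilon> by (intro divide_right_mono) auto
    ultimately have "0 \<le> d * m k + (- 2 * (d * \<epsilon>) * (\<Sum>j\<in>J. p k j) + card J * d\<^sup>2) / (2 * \<epsilon>)"
      by (simp add: F_def a_def[symmetric] b_def[symmetric])
    also have "\<dots> = d * (m k - (\<Sum>j\<in>J. p k j)) + card J * d\<^sup>2 / (2 * \<epsilon>)"
      using \<epsilon> by (simp add: field_simps)
    finally show ?thesis .
  qed
  have varb: "0 \<le> d * (n k - (\<Sum>i\<in>I. p i k)) + card I * d\<^sup>2 / (2 * \<epsilon>)"
    if k: "k \<in> J" and d: "0 \<le> b k + d" "b k + d \<le> 1" for k and d :: real
  proof -
    define b' where "b' = b(k := b k + d)"
    have "(a, b') \<in> B \<times> B" using ab d by (auto simp: b'_def B_def PiE_iff)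
    then have "F z \<le> F (a, b')" by (rule z(2))
    moreover have "(\<Sum>j\<in>J. b' j * n j) = (\<Sum>j\<in>J. b j * n j) + d * n k"
      using k fin by (simp add: b'_def sum.remove algebra_simps)
    moreover have "(\<Sum>j\<in>J. \<Sum>i\<in>I. (q a b' i j)\<^sup>2) \<le> (\<Sum>j\<in>J. \<Sum>i\<in>I. (q a b i j)\<^sup>2)
        - 2 * (d * \<epsilon>) * (\<Sum>i\<in>I. p i k) + card I * d\<^sup>2"
    proof -
      have "(\<Sum>i\<in>I. (q a b' i k)\<^sup>2) \<le> (\<Sum>i\<in>I. (q a b i k)\<^sup>2 - 2 * d * q a b i k + d\<^sup>2)"
        using sq[of "h _ k - a _ - b k" d]
        by (intro sum_mono) (simp add: q_def b'_def algebra_simps)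
      also have "\<dots> = (\<Sum>i\<in>I. (q a b i k)\<^sup>2) - 2 * (d * \<epsilon>) * (\<Sum>i\<in>I. p i k) + card I * d\<^sup>2"
        using \<epsilon> by (simp add: sum.distrib sum_subtractf sum_distrib_left p_def mult.assoc)
      finally have 1: "(\<Sum>i\<in>I. (q a b' i k)\<^sup>2) \<le> \<dots>" .
      have "(\<Sum>j\<in>J - {k}. \<Sum>i\<in>I. (q a b' i j)\<^sup>2) = (\<Sum>j\<in>J - {k}. \<Sum>i\<in>I. (q a b i j)\<^sup>2)"
        by (intro sum.cong) (auto simp: q_def b'_def)
      with 1 show ?thesis using k fin by (simp add: sum.remove[of J k])
    qed
    moreover from this have "(\<Sum>i\<in>I. \<Sum>j\<in>J. (q a b' i j)\<^sup>2) / (2 * \<epsilon>) \<le> (\<Sum>i\<in>I. \<Sum>j\<in>J. (q a b i j)\<^sup>2) / (2 * \<epsilon>)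
        + (- 2 * (d * \<epsilon>) * (\<Sum>i\<in>I. p i k) + card I * d\<^sup>2) / (2 * \<epsilon>)"
      unfolding add_divide_distrib[symmetric] sum.swap[of _ J I] using \<epsilon>
      by (intro divide_right_mono) auto
    ultimately have "0 \<le> d * n k + (- 2 * (d * \<epsilon>) * (\<Sum>i\<in>I. p i k) + card I * d\<^sup>2) / (2 * \<epsilon>)"
      by (simp add: F_def a_def[symmetric] b_def[symmetric])
    also have "\<dots> = d * (n k - (\<Sum>i\<in>I. p i k)) + card I * d\<^sup>2 / (2 * \<epsilon>)"
      using \<epsilon> by (simp add: field_simps)
    finally show ?thesis .
  qed
  \<comment> \<open>Dividing by \<open>d\<close> and letting \<open>d\<close> decrease to 0 removes
    the quadratic term and leaves the sign of the first-order coefficient.\<close>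
  have right: "0 \<le> (x::real)" if "\<delta> > 0" and v: "\<And>d. 0 < d \<Longrightarrow> d \<le> \<delta> \<Longrightarrow> 0 \<le> d * x + M * d\<^sup>2" for x M \<delta>
  proof (rule tendsto_lowerbound)
    show "((\<lambda>d. x + M * d) \<longlongrightarrow> x) (at_right 0)" by (auto intro!: tendsto_eq_intros)
    have "0 \<le> x + M * d" if "0 < d" "d < \<delta>" for d
    proof -
      have "0 \<le> d * (x + M * d)" using v[of d] that by (simp add: power2_eq_square algebra_simps)
      then show ?thesis using that by (simp add: zero_le_mult_iff)
    qed
    then show "\<forall>\<^sub>F d in at_right 0. 0 \<le> x + M * d"
      using \<open>\<delta> > 0\<close> by (auto simp: eventually_at_right_field intro!: exI[of _ \<delta>])
  qed simp
  have left: "(x::real) \<le> 0" if "\<delta> > 0" and v: "\<And>d. 0 < d \<Longrightarrow> d \<le> \<delta> \<Longrightarrow> 0 \<le> - d * x + M * (- d)\<^sup>2" for x M \<delta>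
    using right[of \<delta> "- x" M] that by simp
  \<comment> \<open>At the upper end 1 of the box no increase is admissible, but there
    \<open>h \<le> 1\<close> already satisfies the constraint, so the multiplier vanishes.\<close>
  have z1: "p i j = 0" if "a i = 1 \<or> b j = 1" for i j
    using that h[of i j] ab[of i] ab[of j] by (auto simp: p_def q_def)
  have rowle: "(\<Sum>j\<in>J. p i j) \<le> m i" if "i \<in> I" for i
  proof (cases "a i = 1")
    case True then show ?thesis using z1 m by simp
  next
    case False
    have "0 \<le> m i - (\<Sum>j\<in>J. p i j)"
    proof (rule right[of "1 - a i" _ "card J / (2 * \<epsilon>)"])
      show "0 \<le> d * (m i - (\<Sum>j\<in>J. p i j)) + card J / (2 * \<epsilon>) * d\<^sup>2" if "0 < d" "d \<le> 1 - a i" for d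
        using vara[OF \<open>i \<in> I\<close>, of d] that ab[of i] by simp
    qed (use False ab[of i] in simp)
    then show ?thesis by simp
  qed
  have colle: "(\<Sum>i\<in>I. p i j) \<le> n j" if "j \<in> J" for j
  proof (cases "b j = 1")
    case True then show ?thesis using z1 n by simp
  next
    case False
    have "0 \<le> n j - (\<Sum>i\<in>I. p i j)"
    proof (rule right[of "1 - b j" _ "card I / (2 * \<epsilon>)"])
      show "0 \<le> d * (n j - (\<Sum>i\<in>I. p i j)) + card I / (2 * \<epsilon>) * d\<^sup>2" if "0 < d" "d \<le> 1 - b j" for d
        using varb[OF \<open>j \<in> J\<close>, of d] that ab[of j] by simp
    qed (use False ab[of j] in simp)
    then show ?thesis by simp
  qed
  \<comment> \<open>Complementary slackness: if \<open>a i > 0\<close>, decreasing it is admissible,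
    so the row sum is at least \<open>m i\<close>.\<close>
  have rowge: "a i * m i \<le> a i * (\<Sum>j\<in>J. p i j)" if "i \<in> I" for i
  proof (cases "a i = 0")
    case False
    have "m i - (\<Sum>j\<in>J. p i j) \<le> 0"
    proof (rule left[of "a i" _ "card J / (2 * \<epsilon>)"])
      show "0 \<le> - d * (m i - (\<Sum>j\<in>J. p i j)) + card J / (2 * \<epsilon>) * (- d)\<^sup>2" if "0 < d" "d \<le> a i" for d
        using vara[OF \<open>i \<in> I\<close>, of "- d"] that ab[of i] by simp
    qed (use False ab[of i] in simp)
    then show ?thesis using ab by (intro mult_left_mono) auto
  qed simp
  have colge: "b j * n j \<le> b j * (\<Sum>i\<in>I. p i j)" if "j \<in> J" for j
  proof (cases "b j = 0")
    case False
    have "n j - (\<Sum>i\<in>I. p i j) \<le> 0"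
    proof (rule left[of "b j" _ "card I / (2 * \<epsilon>)"])
      show "0 \<le> - d * (n j - (\<Sum>i\<in>I. p i j)) + card I / (2 * \<epsilon>) * (- d)\<^sup>2" if "0 < d" "d \<le> b j" for d
        using varb[OF \<open>j \<in> J\<close>, of "- d"] that ab[of j] by simp
    qed (use False ab[of j] in simp)
    then show ?thesis using ab by (intro mult_left_mono) auto
  qed simp
  have "(\<Sum>i\<in>I. a i * m i) + (\<Sum>j\<in>J. b j * n j)
      \<le> (\<Sum>i\<in>I. a i * (\<Sum>j\<in>J. p i j)) + (\<Sum>j\<in>J. b j * (\<Sum>i\<in>I. p i j))"
    by (intro add_mono sum_mono rowge colge)
  also have "\<dots> = (\<Sum>i\<in>I. \<Sum>j\<in>J. (a i + b j) * p i j)"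
    using sum.swap[of "\<lambda>i j. b j * p i j" J I] by (simp add: sum_distrib_left sum.distrib algebra_simps)
  \<comment> \<open>Where \<open>p i j\<close> is nonzero the constraint is violated, so
    \<open>a i + b j < h i j\<close> there.\<close>
  also have "\<dots> \<le> (\<Sum>i\<in>I. \<Sum>j\<in>J. h i j * p i j)"
  proof (intro sum_mono)
    fix i j show "(a i + b j) * p i j \<le> h i j * p i j"
      using \<epsilon> by (cases "h i j - a i - b j \<le> 0") (auto simp: p_def q_def max_def intro!: mult_right_mono divide_right_mono)
  qed
  finally have "(\<Sum>i\<in>I. a i * m i) + (\<Sum>j\<in>J. b j * n j) \<le> (\<Sum>i\<in>I. \<Sum>j\<in>J. h i j * p i j)" .
  moreover have "h i j \<le> a i + b j + \<epsilon> * p i j" for i j using \<epsilon> by (auto simp: p_def q_def)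
  ultimately show ?thesis using that ab p0 rowle colle by blast
qed

subsection \<open>Continuity of the covering value from below\<close>

text \<open>Each triple \<open>(x, y, t)\<close> in \<open>E\<close> is one constraint on the
  potentials; for the hypograph of a gain they amount to domination of the gain. Constraints hold at
  every point, not only almost everywhere. Emptiness expresses that no cover with values in
  \<open>[0,1]\<close> costs at most \<open>L\<close>.\<close>

definition cover_pairs :: "'a measure \<Rightarrow> 'b measure \<Rightarrow> ('a \<times> 'b \<times> real) set \<Rightarrow> real
    \<Rightarrow> (('a \<Rightarrow> real) \<times> ('b \<Rightarrow> real)) set" where
  "cover_pairs M N E L = {(\<phi>, \<psi>). \<phi> \<in> borel_measurable M \<and> \<psi> \<in> borel_measurable N \<and>
     (\<forall>x. \<phi> x \<in> {0..1}) \<and> (\<forall>y. \<psi> y \<in> {0..1}) \<and>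
     (\<forall>(x, y, t)\<in>E. t \<le> \<phi> x + \<psi> y) \<and> integral\<^sup>L M \<phi> + integral\<^sup>L N \<psi> \<le> L}"

text \<open>The inequality \<open>u \<le> 2 ^ k * u ^ 2 + 2 ^ (-k)\<close> turns squared L2
  increments of order \<open>8 ^ (-k)\<close> into summable L1 increments. Their sum is then finite
  almost everywhere, which gives absolute convergence of the telescoping series.\<close>

lemma AE_convergent_if_L2_fast:
  fixes f :: "nat \<Rightarrow> 'a \<Rightarrow> real"
  assumes "prob_space M" and [measurable]: "\<And>k. f k \<in> borel_measurable M"
    and f01: "\<And>k x. f k x \<in> {0..1}"
    and fast: "\<And>k. (\<integral>x. (f k x - f (Suc k) x)\<^sup>2 \<partial>M) \<le> c * (1 / 8) ^ k"
  shows "AE x in M. convergent (\<lambda>k. f k x)"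
proof -
  interpret prob_space M by fact
  define g where "g k x = \<bar>f k x - f (Suc k) x\<bar>" for k x
  have [measurable]: "g k \<in> borel_measurable M" for k unfolding g_def by measurable
  have g01: "0 \<le> g k x" "g k x \<le> 1" for k x using f01[of k x] f01[of "Suc k" x] by (auto simp: g_def)
  have g2: "(g k x)\<^sup>2 \<le> 1" for k x using g01[of k x] by (simp add: power_le_one)
  have int: "integrable M (g k)" "integrable M (\<lambda>x. (g k x)\<^sup>2)" for k
    using g01[of k] g2[of k] by (auto intro!: integrable_const_bound[where B = 1])
  have "integral\<^sup>L M (g k) \<le> c * (1 / 4) ^ k + (1 / 2) ^ k" for k
  proof -
    have le: "g k x \<le> 2 ^ k * (g k x)\<^sup>2 + (1 / 2) ^ k" for x
    proof -
      have "0 \<le> (2 ^ k * g k x - 1 / 2)\<^sup>2 + 3 / 4" by simp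
      also have "\<dots> = 2 ^ k * (2 ^ k * (g k x)\<^sup>2 + (1 / 2) ^ k - g k x)"
        by (simp add: power2_eq_square algebra_simps power_one_over)
      finally show ?thesis using zero_less_power[of "2 :: real" k] unfolding zero_le_mult_iff by linarith
    qed
    have "integral\<^sup>L M (g k) \<le> (\<integral>x. 2 ^ k * (g k x)\<^sup>2 + (1 / 2) ^ k \<partial>M)"
      by (intro integral_mono le int Bochner_Integration.integrable_add integrable_mult_right) auto
    also have "\<dots> = 2 ^ k * (\<integral>x. (g k x)\<^sup>2 \<partial>M) + (1 / 2) ^ k"
      using int by (simp add: prob_space)
    also have "\<dots> \<le> 2 ^ k * (c * (1 / 8) ^ k) + (1 / 2) ^ k"
      using fast[of k] by (simp add: g_def)
    also have "2 ^ k * (c * (1 / 8) ^ k) = c * (1 / 4 :: real) ^ k"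
      by (simp add: power_divide flip: power_mult_distrib) (simp add: field_simps flip: power_mult_distrib)
    finally show ?thesis .
  qed
  moreover have "summable (\<lambda>k. c * (1 / 4) ^ k + (1 / 2 :: real) ^ k)"
    by (intro summable_add summable_mult summable_geometric) auto
  ultimately have sum: "summable (\<lambda>k. integral\<^sup>L M (g k))"
    using g01 by (intro summable_comparison_test'[of _ 0 "\<lambda>k. integral\<^sup>L M (g k)"])
      (simp_all add: integral_nonneg_AE)
  have "(\<integral>\<^sup>+x. (\<Sum>k. ennreal (g k x)) \<partial>M) = (\<Sum>k. \<integral>\<^sup>+x. ennreal (g k x) \<partial>M)"
    by (intro nn_integral_suminf) simp
  also have "\<dots> = (\<Sum>k. ennreal (integral\<^sup>L M (g k)))"
    using g01 int by (intro suminf_cong nn_integral_eq_integral) auto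
  also have "\<dots> = ennreal (\<Sum>k. integral\<^sup>L M (g k))"
    using g01 by (intro suminf_ennreal2 sum integral_nonneg_AE) auto
  also have "\<dots> \<noteq> \<infinity>" by simp
  finally have "AE x in M. (\<Sum>k. ennreal (g k x)) \<noteq> \<infinity>"
    by (intro nn_integral_PInf_AE) auto
  then show ?thesis
  proof eventually_elim
    case (elim x)
    then have "summable (\<lambda>k. g k x)" using g01 by (intro summable_suminf_not_top) auto
    then have "summable (\<lambda>k. f k x - f (Suc k) x)" unfolding g_def by (rule summable_rabs_cancel)
    then have "summable (\<lambda>k. - (f k x - f (Suc k) x))" by (rule summable_minus)
    then have "convergent (\<lambda>n. \<Sum>k<n. f (Suc k) x - f k x)" by (simp add: summable_iff_convergent)
    moreover have "(\<Sum>k<n. f (Suc k) x - f k x) = f n x - f 0 x" for n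
      by (rule sum_lessThan_telescope)
    ultimately show ?case
      using convergent_add_const_iff[of "- f 0 x" "\<lambda>n. f n x"] by simp
  qed
qed

text \<open>The upper limit is defined at every point, unlike the almost everywhere limit with which
  it agrees, so pointwise constraints can be passed to it. Dominated convergence handles the
  integrals.\<close>

lemma integral_limsup:
  fixes f :: "nat \<Rightarrow> 'a \<Rightarrow> real"
  assumes "prob_space M" and [measurable]: "\<And>k. f k \<in> borel_measurable M"
    and f01: "\<And>k x. f k x \<in> {0..1}" and conv: "AE x in M. convergent (\<lambda>k. f k x)"
    and g_def: "g = (\<lambda>x. real_of_ereal (limsup (\<lambda>k. ereal (f k x))))"
  shows "g \<in> borel_measurable M" "\<And>x. g x \<in> {0..1}" "\<And>x. limsup (\<lambda>k. ereal (f k x)) = ereal (g x)"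
    "(\<lambda>k. integral\<^sup>L M (f k)) \<longlonglongrightarrow> integral\<^sup>L M g"
proof -
  interpret prob_space M by fact
  show meas[measurable]: "g \<in> borel_measurable M" unfolding g_def by measurable
  have le: "limsup (\<lambda>k. ereal (f k x)) \<le> 1" for x
    using f01 by (intro Limsup_bounded always_eventually) auto
  have ge: "0 \<le> limsup (\<lambda>k. ereal (f k x))" for x
    using f01 by (intro le_Limsup always_eventually) auto
  show eq: "limsup (\<lambda>k. ereal (f k x)) = ereal (g x)" for x
    using le[of x] ge[of x] unfolding g_def by (cases "limsup (\<lambda>k. ereal (f k x))") auto
  show "g x \<in> {0..1}" for x using le[of x] ge[of x] by (simp add: eq one_ereal_def zero_ereal_def)
  show "(\<lambda>k. integral\<^sup>L M (f k)) \<longlonglongrightarrow> integral\<^sup>L M g"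
  proof (rule integral_dominated_convergence[where w = "\<lambda>_. 1"])
    show "AE x in M. (\<lambda>k. f k x) \<longlonglongrightarrow> g x"
      using conv
    proof eventually_elim
      case (elim x)
      then obtain l where l: "(\<lambda>k. f k x) \<longlonglongrightarrow> l" by (auto simp: convergent_def)
      then have "(\<lambda>k. ereal (f k x)) \<longlonglongrightarrow> ereal l" by simp
      then have "limsup (\<lambda>k. ereal (f k x)) = ereal l" by (rule lim_imp_Limsup[OF sequentially_bot])
      then show ?case using l by (simp add: eq)
    qed
  qed (use f01 in auto)
qed

text \<open>Nearly norm-minimal elements of the decreasing convex sets \<open>cover_pairs M N (E n) L\<close> form a
  Cauchy sequence in \<open>L\<^sup>2\<close>, by the parallelogram identity.\<close>

lemma cover_pairs_UN:
  assumes M: "prob_space M" and N: "prob_space N" and E: "incseq E"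
    and ne: "\<And>n. cover_pairs M N (E n) L \<noteq> {}"
  shows "cover_pairs M N (\<Union>n. E n) L \<noteq> {}"
proof -
  interpret M: prob_space M by fact
  interpret N: prob_space N by fact
  define C where "C n = cover_pairs M N (E n) L" for n
  define q where "q w = (\<integral>x. (fst w x)\<^sup>2 \<partial>M) + (\<integral>y. (snd w y)\<^sup>2 \<partial>N)"
    for w :: "('a \<Rightarrow> real) \<times> ('b \<Rightarrow> real)"
  define dst where "dst v w = (\<integral>x. (fst v x - fst w x)\<^sup>2 \<partial>M) + (\<integral>y. (snd v y - snd w y)\<^sup>2 \<partial>N)"
    for v w :: "('a \<Rightarrow> real) \<times> ('b \<Rightarrow> real)"
  define mid where "mid v w = (\<lambda>x. (fst v x + fst w x) / 2, \<lambda>y. (snd v y + snd w y) / 2)"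
    for v w :: "('a \<Rightarrow> real) \<times> ('b \<Rightarrow> real)"
  have Cmono: "C m \<subseteq> C n" if "n \<le> m" for m n
    using incseqD[OF E that] unfolding C_def cover_pairs_def by fastforce
  have Cmeas: "fst w \<in> borel_measurable M" "snd w \<in> borel_measurable N"
    and C01: "0 \<le> fst w x \<and> fst w x \<le> 1 \<and> 0 \<le> snd w y \<and> snd w y \<le> 1" if "w \<in> C n" for w n x y
    using that by (auto simp: C_def cover_pairs_def)
  have Ccov: "t \<le> fst w x + snd w y" if "w \<in> C n" "(x, y, t) \<in> E n" for w n x y t
    using that by (auto simp: C_def cover_pairs_def)
  have Cint: "integral\<^sup>L M (fst w) + integral\<^sup>L N (snd w) \<le> L" if "w \<in> C n" for w n
    using that by (auto simp: C_def cover_pairs_def)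
  have intM: "integrable M f" if "f \<in> borel_measurable M" "\<And>x. \<bar>f x\<bar> \<le> 1" for f :: "'a \<Rightarrow> real"
    using that by (auto intro!: M.integrable_const_bound[where B = 1])
  have intN: "integrable N f" if "f \<in> borel_measurable N" "\<And>x. \<bar>f x\<bar> \<le> 1" for f :: "'b \<Rightarrow> real"
    using that by (auto intro!: N.integrable_const_bound[where B = 1])
  have q0: "0 \<le> q w" for w by (simp add: q_def)
  have q2: "q w \<le> 2" if "w \<in> C n" for w n
  proof -
    have "(\<integral>x. (fst w x)\<^sup>2 \<partial>M) \<le> 1" "(\<integral>y. (snd w y)\<^sup>2 \<partial>N) \<le> 1"
      using C01[OF that] by (auto intro!: M.integral_le_const N.integral_le_const M.integrable_const_bound[where B = 1]
        N.integrable_const_bound[where B = 1] Cmeas[OF that] borel_measurable_power simp: power_le_one)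
    then show ?thesis by (simp add: q_def)
  qed
  have avg: "t \<le> (a + c) / 2 + (b + d) / 2" if "t \<le> a + b" "t \<le> c + d" for a b c d t :: real
    using that by argo
  have midC: "mid v w \<in> C n" if vw: "v \<in> C n" "w \<in> C n" for v w n
  proof -
    note [measurable] = Cmeas[OF vw(1)] Cmeas[OF vw(2)]
    have i: "integrable M (fst v)" "integrable M (fst w)" "integrable N (snd v)" "integrable N (snd w)"
      using C01[OF vw(1)] C01[OF vw(2)] by (auto intro!: intM intN)
    have "t \<le> (fst v x + fst w x) / 2 + (snd v y + snd w y) / 2" if "(x, y, t) \<in> E n" for x y t
    proof -
      have "t \<le> fst v x + snd v y" "t \<le> fst w x + snd w y"
        using vw that by (auto intro: Ccov)
      then show ?thesis by (rule avg)
    qed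
    moreover have "(fst v x + fst w x) / 2 \<in> {0..1}" "(snd v y + snd w y) / 2 \<in> {0..1}" for x y
      using C01[OF vw(1), of x y] C01[OF vw(2), of x y] by auto
    moreover have "(\<integral>x. (fst v x + fst w x) / 2 \<partial>M) + (\<integral>y. (snd v y + snd w y) / 2 \<partial>N) \<le> L"
    proof -
      have "integral\<^sup>L M (fst v) + integral\<^sup>L N (snd v) \<le> L" "integral\<^sup>L M (fst w) + integral\<^sup>L N (snd w) \<le> L"
        using vw by (auto intro: Cint)
      then show ?thesis using i by (simp add: field_simps)
    qed
    moreover have "(\<lambda>x. (fst v x + fst w x) / 2) \<in> borel_measurable M" "(\<lambda>y. (snd v y + snd w y) / 2) \<in> borel_measurable N"
      by measurable
    ultimately show ?thesis
      unfolding C_def cover_pairs_def mid_def by blast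
  qed
  have par: "dst v w = 2 * q v + 2 * q w - 4 * q (mid v w)" if vw: "v \<in> C n" "w \<in> C n" for v w n
  proof -
    note [measurable] = Cmeas[OF vw(1)] Cmeas[OF vw(2)]
    have b: "(fst v x)\<^sup>2 \<le> 1" "(fst w x)\<^sup>2 \<le> 1" "(snd v y)\<^sup>2 \<le> 1" "(snd w y)\<^sup>2 \<le> 1"
      "\<bar>fst v x * fst w x\<bar> \<le> 1" "\<bar>snd v y * snd w y\<bar> \<le> 1" for x y
      using C01[OF vw(1), of x y] C01[OF vw(2), of x y] by (auto simp: power_le_one mult_le_one)
    have i: "integrable M (\<lambda>x. (fst v x)\<^sup>2)" "integrable M (\<lambda>x. (fst w x)\<^sup>2)" "integrable M (\<lambda>x. fst v x * fst w x)"
      "integrable N (\<lambda>x. (snd v x)\<^sup>2)" "integrable N (\<lambda>x. (snd w x)\<^sup>2)" "integrable N (\<lambda>x. snd v x * snd w x)"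
      using b by (auto intro!: intM intN)
    have e: "(a - b)\<^sup>2 = (a\<^sup>2 + b\<^sup>2) - 2 * (a * b)" "((a + b) / 2)\<^sup>2 = (a\<^sup>2 + b\<^sup>2 + 2 * (a * b)) / 4" for a b :: real
      by (auto simp: power2_eq_square field_simps)
    show ?thesis
      unfolding dst_def q_def mid_def fst_conv snd_conv e using i by (simp add: add_divide_distrib)
  qed
  \<comment> \<open>Least squared norm over \<open>C n\<close>. As the sets shrink with
    \<open>n\<close> these values increase, and they stay below 2.\<close>
  define d where "d n = Inf (q ` C n)" for n
  have bdd: "bdd_below (q ` C n)" for n by (rule bdd_belowI2[OF q0])
  have neC: "q ` C n \<noteq> {}" for n using ne by (simp add: C_def)
  have dle: "d n \<le> q w" if "w \<in> C n" for n w
    unfolding d_def using that bdd by (auto intro: cInf_lower)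
  have dinc: "incseq d"
    unfolding incseq_def d_def by (auto intro!: cInf_superset_mono neC bdd image_mono Cmono)
  have d2: "d n \<le> 2" for n using neC[of n] dle[of _ n] q2 by force
  obtain dl where dl: "d \<longlonglongrightarrow> dl" "\<forall>n. d n \<le> dl"
    using incseq_convergent[OF dinc] d2 by metis
  define e :: "nat \<Rightarrow> real" where "e k = (1 / 8) ^ k" for k
  have e: "0 < e k" "e (Suc k) = e k / 8" for k by (simp_all add: e_def)
  \<comment> \<open>The index \<open>n\<close> is taken so large that \<open>d n\<close> is within
    \<open>e k\<close> of the limit. It is recorded because near-minimality of \<open>w\<close>
    refers to \<open>C n\<close>, a subset of \<open>C k\<close>.\<close>
  have "\<exists>w. w \<in> C k \<and> (\<exists>n. w \<in> C n \<and> q w \<le> d n + e k \<and> dl \<le> d n + e k)" for k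
  proof -
    have "\<forall>\<^sub>F n in sequentially. dl - e k < d n"
      using dl(1) by (rule order_tendstoD) (simp add: e)
    then obtain n where n: "n \<ge> k" "dl - e k < d n"
      by (metis (mono_tags, lifting) eventually_sequentially nat_le_linear)
    have "Inf (q ` C n) < d n + e k" by (simp add: d_def[symmetric] e)
    then obtain w where "w \<in> C n" "q w < d n + e k"
      using cInf_lessD[OF neC] by blast
    then show ?thesis using n Cmono[OF n(1)] by (intro exI[of _ w]) (auto intro!: exI[of _ n])
  qed
  then obtain w nn where w: "\<And>k. w k \<in> C k" "\<And>k. w k \<in> C (nn k)" "\<And>k. q (w k) \<le> d (nn k) + e k"
    "\<And>k. dl \<le> d (nn k) + e k" by metis
  have fast: "dst (w k) (w (Suc k)) \<le> 8 * e k" for k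
  proof -
    \<comment> \<open>Both points lie in the larger of their two sets, and so does their midpoint,
      whose squared norm is at least \<open>d n\<close>; the parallelogram identity then bounds the
      distance.\<close>
    define n where "n = min (nn k) (nn (Suc k))"
    have n: "w k \<in> C n" "w (Suc k) \<in> C n"
      using w(2) Cmono[of n "nn k"] Cmono[of n "nn (Suc k)"] by (auto simp: n_def)
    have "d n \<le> q (mid (w k) (w (Suc k)))" by (intro dle midC n)
    moreover have "dl \<le> d n + e k"
      using w(4)[of k] w(4)[of "Suc k"] e[of k] by (cases "nn k \<le> nn (Suc k)") (auto simp: n_def min_def)
    moreover have "q (w k) \<le> dl + e k" "q (w (Suc k)) \<le> dl + e (Suc k)"
      using w(3)[of k] w(3)[of "Suc k"] dl(2)[rule_format, of "nn k"] dl(2)[rule_format, of "nn (Suc k)"] by linarith+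
    ultimately show ?thesis using par[OF n] e[of k] by linarith
  qed
  define f g where "f k = fst (w k)" and "g k = snd (w k)" for k
  have fg: "f k \<in> borel_measurable M" "g k \<in> borel_measurable N" "f k x \<in> {0..1}" "g k y \<in> {0..1}" for k x y
    using Cmeas[OF w(1)[of k]] C01[OF w(1)[of k], of x y] by (auto simp: f_def g_def)
  have nonneg: "0 \<le> (\<integral>x. (f k x - f (Suc k) x)\<^sup>2 \<partial>M)" "0 \<le> (\<integral>y. (g k y - g (Suc k) y)\<^sup>2 \<partial>N)" for k by auto
  have fastf: "(\<integral>x. (f k x - f (Suc k) x)\<^sup>2 \<partial>M) \<le> 8 * (1 / 8) ^ k"
    and fastg: "(\<integral>y. (g k y - g (Suc k) y)\<^sup>2 \<partial>N) \<le> 8 * (1 / 8) ^ k" for k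
    using fast[of k] nonneg[of k] unfolding dst_def f_def[symmetric] g_def[symmetric] e_def by linarith+
  define \<phi> where "\<phi> = (\<lambda>x. real_of_ereal (limsup (\<lambda>k. ereal (f k x))))"
  define \<psi> where "\<psi> = (\<lambda>y. real_of_ereal (limsup (\<lambda>k. ereal (g k y))))"
  note \<phi> = integral_limsup[OF M fg(1) fg(3) AE_convergent_if_L2_fast[OF M fg(1) fg(3) fastf] \<phi>_def]
  note \<psi> = integral_limsup[OF N fg(2) fg(4) AE_convergent_if_L2_fast[OF N fg(2) fg(4) fastg] \<psi>_def]
  \<comment> \<open>A point of the union is covered by all late pairs. Subadditivity of the upper
    limit preserves the constraint at that very point, with no exceptional null set.\<close>
  have "t \<le> \<phi> x + \<psi> y" if "(x, y, t) \<in> E n" for x y t n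
  proof -
    have "t \<le> f k x + g k y" if "n \<le> k" for k
      using Ccov[OF w(1)[of k]] incseqD[OF E that] \<open>(x, y, t) \<in> E n\<close> by (auto simp: f_def g_def)
    then have "ereal t \<le> limsup (\<lambda>k. ereal (f k x) + ereal (g k y))"
      by (intro le_Limsup) (auto simp: eventually_sequentially)
    also have "\<dots> \<le> limsup (\<lambda>k. ereal (f k x)) + limsup (\<lambda>k. ereal (g k y))"
      by (rule ereal_limsup_add_mono)
    finally show ?thesis by (simp add: \<phi>(3) \<psi>(3))
  qed
  moreover have "integral\<^sup>L M \<phi> + integral\<^sup>L N \<psi> \<le> L"
  proof (rule LIMSEQ_le_const2[OF tendsto_add[OF \<phi>(4) \<psi>(4)]])
    show "\<exists>K. \<forall>n\<ge>K. integral\<^sup>L M (f n) + integral\<^sup>L N (g n) \<le> L"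
      using Cint[OF w(1)] by (auto simp: f_def g_def)
  qed
  ultimately have "(\<phi>, \<psi>) \<in> cover_pairs M N (\<Union>n. E n) L"
    using \<phi>(1,2) \<psi>(1,2) unfolding cover_pairs_def by blast
  then show ?thesis by blast
qed

subsection \<open>Analytic sets and capacities\<close>

text \<open>Suslin's description: the projection of a closed set along Baire space
  \<open>nat \<Rightarrow> nat\<close>.\<close>

definition analytic :: "'z::topological_space set \<Rightarrow> bool" where
  "analytic E \<longleftrightarrow> (\<exists>C :: ('z \<times> (nat \<Rightarrow> nat)) set. closed C \<and> E = fst ` C)"

lemma analytic_closed: "closed E \<Longrightarrow> analytic E"
  unfolding analytic_def by (intro exI[of _ "E \<times> UNIV"]) (auto simp: closed_Times)

lemma closed_vimage_reindex:
  fixes C :: "('z::topological_space \<times> (nat \<Rightarrow> nat)) set" and g :: "nat \<Rightarrow> nat"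
  assumes "closed C"
  shows "closed ((\<lambda>p. (fst p, \<lambda>k. snd p (g k))) -` C)"
proof (rule closed_vimage[OF assms])
  have "continuous_on UNIV (\<lambda>p::'z \<times> (nat \<Rightarrow> nat). snd p k)" for k
    by (rule continuous_on_product_then_coordinatewise) (intro continuous_intros)
  then show "continuous_on UNIV (\<lambda>p::'z \<times> (nat \<Rightarrow> nat). (fst p, \<lambda>k. snd p (g k)))"
    by (intro continuous_on_Pair continuous_on_coordinatewise_then_product continuous_intros)
qed

text \<open>Coordinate 0 of the parameter names a set of the family and the shifted sequence is a
  witness for membership in it. The selection clause is closed because that coordinate is locally
  constant.\<close>

lemma analytic_UN:
  assumes "\<And>n::nat. analytic (E n)"
  shows "analytic (\<Union>n. E n)"
proof -
  obtain C where C: "\<And>n. closed (C n)" "\<And>n. E n = fst ` (C n :: ('a \<times> (nat \<Rightarrow> nat)) set)"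
    using assms unfolding analytic_def by metis
  define C' where "C' = (\<Inter>n. {p. snd p 0 \<noteq> n} \<union> (\<lambda>p. (fst p, \<lambda>k. snd p (Suc k))) -` C n)"
  have cont: "continuous_on UNIV (\<lambda>p::'a \<times> (nat \<Rightarrow> nat). snd p 0)"
    by (rule continuous_on_product_then_coordinatewise) (intro continuous_intros)
  have "closed {p::'a \<times> (nat \<Rightarrow> nat). snd p 0 \<noteq> n}" for n
  proof -
    have "open ((\<lambda>p::'a \<times> (nat \<Rightarrow> nat). snd p 0) -` {n})"
      by (rule open_vimage[OF discrete_topology_class.open_discrete cont])
    moreover have "(\<lambda>p::'a \<times> (nat \<Rightarrow> nat). snd p 0) -` {n} = - {p. snd p 0 \<noteq> n}" by auto
    ultimately show ?thesis unfolding closed_def by simp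
  qed
  then have "closed C'"
    unfolding C'_def by (intro closed_INT ballI closed_Un closed_vimage_reindex C)
  moreover have "(\<Union>n. E n) = fst ` C'"
  proof (intro equalityI subsetI)
    fix z assume "z \<in> (\<Union>n. E n)"
    then obtain n \<sigma> where "(z, \<sigma>) \<in> C n" using C(2) by fastforce
    then have "(z, \<lambda>k. case k of 0 \<Rightarrow> n | Suc k \<Rightarrow> \<sigma> k) \<in> C'" by (auto simp: C'_def)
    then show "z \<in> fst ` C'" by force
  qed (force simp: C'_def C(2))
  ultimately show ?thesis unfolding analytic_def by blast
qed

text \<open>The pairing function merges one witness for each set into a single point of Baire
  space.\<close>

lemma analytic_INT:
  assumes "\<And>n::nat. analytic (E n)"
  shows "analytic (\<Inter>n. E n)"
proof -
  obtain C where C: "\<And>n. closed (C n)" "\<And>n. E n = fst ` (C n :: ('a \<times> (nat \<Rightarrow> nat)) set)"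
    using assms unfolding analytic_def by metis
  define C' where "C' = (\<Inter>n. (\<lambda>p. (fst p, \<lambda>k. snd p (prod_encode (n, k)))) -` C n)"
  have "closed C'"
    unfolding C'_def by (intro closed_INT ballI closed_vimage_reindex C)
  moreover have "(\<Inter>n. E n) = fst ` C'"
  proof (intro equalityI subsetI)
    fix z assume "z \<in> (\<Inter>n. E n)"
    then have "\<forall>n. \<exists>\<sigma>. (z, \<sigma>) \<in> C n" using C(2) by fastforce
    then obtain \<sigma> where "\<And>n. (z, \<sigma> n) \<in> C n" by metis
    then have "(z, \<lambda>k. case prod_decode k of (n, k) \<Rightarrow> \<sigma> n k) \<in> C'" by (auto simp: C'_def)
    then show "z \<in> fst ` C'" by force
  qed (force simp: C'_def C(2))
  ultimately show ?thesis unfolding analytic_def by blast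
qed

text \<open>An open set in a metric space is the countable union of the closed sets of points at
  distance at least \<open>1 / (n + 1)\<close> from its complement.\<close>

lemma analytic_open:
  fixes U :: "'z::metric_space set"
  assumes "open U"
  shows "analytic U"
proof (cases "U = UNIV")
  case False
  have "- U \<noteq> {}" using False by auto
  have "U = (\<Union>n. {x. inverse (real (Suc n)) \<le> infdist x (- U)})"
  proof (intro equalityI subsetI)
    fix x assume "x \<in> U"
    then have "0 < infdist x (- U)"
      using in_closed_iff_infdist_zero[of "- U" x] assms \<open>- U \<noteq> {}\<close> infdist_nonneg[of x "- U"]
      by (auto simp: less_le)
    then show "x \<in> (\<Union>n. {x. inverse (real (Suc n)) \<le> infdist x (- U)})"
      using reals_Archimedean by (auto intro: less_imp_le)
  next
    fix x assume "x \<in> (\<Union>n. {x. inverse (real (Suc n)) \<le> infdist x (- U)})"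
    then obtain n where n: "inverse (real (Suc n)) \<le> infdist x (- U)" by auto
    show "x \<in> U"
    proof (rule ccontr)
      assume "x \<notin> U"
      then have "infdist x (- U) = 0" by (auto intro: infdist_zero)
      with n have "inverse (real (Suc n)) \<le> 0" by simp
      then show False by simp
    qed
  qed
  moreover have "analytic (\<Union>n. {x. inverse (real (Suc n)) \<le> infdist x (- U)})"
    by (intro analytic_UN analytic_closed closed_Collect_le continuous_intros continuous_on_infdist)
  ultimately show ?thesis by simp
qed (auto intro: analytic_closed)

text \<open>Complementation need not preserve analyticity, so the induction carries a set and its
  complement together.\<close>

lemma analytic_borel:
  fixes E :: "'z::metric_space set"
  assumes "E \<in> sets borel"
  shows "analytic E"
proof -
  have "E \<in> sigma_sets UNIV {S :: 'z set. open S}"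
    using assms by (simp add: borel_def)
  then have "analytic E \<and> analytic (- E)"
  proof induction
    case (Basic a)
    then show ?case by (auto intro: analytic_open analytic_closed)
  next
    case Empty
    show ?case by (auto intro: analytic_closed)
  next
    case (Compl a)
    then show ?case by (simp add: Compl_eq_Diff_UNIV[symmetric])
  next
    case (Union a)
    then show ?case by (auto intro: analytic_UN analytic_INT)
  qed
  then show ?thesis ..
qed

text \<open>The closed sets produced here are closures of images of the pieces of \<open>C\<close> on which the first
  \<open>n\<close> coordinates of the Baire parameter are bounded; their intersection stays in \<open>E\<close> because
  parameters approximating a point of it lie in a compact box.\<close>

lemma capacity_approximation:
  fixes V :: "'z::metric_space set \<Rightarrow> bool"
  assumes mono: "\<And>A B. A \<subseteq> B \<Longrightarrow> V A \<Longrightarrow> V B"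
    and up: "\<And>A :: nat \<Rightarrow> 'z set. incseq A \<Longrightarrow> V (\<Union>n. A n) \<Longrightarrow> \<exists>n. V (A n)"
    and E: "E \<in> sets borel" "V E"
  obtains K :: "nat \<Rightarrow> 'z set" where "\<And>n. closed (K n)" "decseq K" "\<And>n. V (K n)"
    "(\<Inter>n. K n) \<subseteq> E" "\<And>n. K n \<subseteq> closure E"
proof -
  obtain C :: "('z \<times> (nat \<Rightarrow> nat)) set" where C: "closed C" "E = fst ` C"
    using analytic_borel[OF E(1)] unfolding analytic_def by blast
  define F where "F l = fst ` {p \<in> C. \<forall>i<length l. snd p i \<le> l ! i}" for l
  \<comment> \<open>Bounding one more coordinate by \<open>k\<close> exhausts \<open>F l\<close> as
    \<open>k\<close> grows; continuity from below provides a finite bound that keeps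
    \<open>V\<close>.\<close>
  have step: "\<exists>k. V (F (l @ [k]))" if "V (F l)" for l
  proof -
    have eq: "F (l @ [k]) = fst ` {p \<in> C. (\<forall>i<length l. snd p i \<le> l ! i) \<and> snd p (length l) \<le> k}" for k
      unfolding F_def by (intro arg_cong[where f = "image fst"] Collect_cong) (auto simp: nth_append less_Suc_eq)
    have "incseq (\<lambda>k. F (l @ [k]))"
      unfolding incseq_def eq by (intro allI impI image_mono) auto
    moreover have "F l = (\<Union>k. F (l @ [k]))"
      unfolding eq by (auto simp: F_def)
    ultimately show ?thesis using up that by metis
  qed
  have "\<exists>f. \<forall>n. (V (F (f n)) \<and> length (f n) = n) \<and> (\<exists>k. f (Suc n) = f n @ [k])"
  proof (rule dependent_nat_choice)
    show "\<exists>l. V (F l) \<and> length l = 0" using E(2) by (auto simp: F_def C(2))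
    show "\<exists>l'. (V (F l') \<and> length l' = Suc n) \<and> (\<exists>k. l' = l @ [k])"
      if "V (F l) \<and> length l = n" for l n
      using step[of l] that by auto
  qed
  then obtain f where f: "\<And>n. V (F (f n))" "\<And>n. length (f n) = n" "\<And>n. \<exists>k. f (Suc n) = f n @ [k]"
    by blast
  define s where "s i = f (Suc i) ! i" for i
  have fs: "i < n \<Longrightarrow> f n ! i = s i" for i n
  proof (induction n)
    case (Suc n)
    then show ?case using f(2)[of n] f(3)[of n] by (cases "i = n") (auto simp: s_def nth_append)
  qed simp
  have F_eq: "F (f n) = fst ` {p \<in> C. \<forall>i<n. snd p i \<le> s i}" for n
    unfolding F_def using f(2) fs by auto
  define K where "K n = closure (F (f n))" for n
  have FE: "F (f n) \<subseteq> E" for n by (auto simp: F_def C(2))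
  have "z \<in> E" if z: "z \<in> (\<Inter>n. K n)" for z
  proof -
    have "\<exists>p. p \<in> C \<and> (\<forall>i<n. snd p i \<le> s i) \<and> dist (fst p) z < inverse (real (Suc n))" for n
    proof -
      have "\<exists>y\<in>F (f n). dist y z < inverse (real (Suc n))"
        using z by (auto simp: K_def closure_approachable simp del: of_nat_Suc)
      then show ?thesis unfolding F_eq by auto
    qed
    then obtain p where p: "\<And>n. p n \<in> C" "\<And>n i. i < n \<Longrightarrow> snd (p n) i \<le> s i"
      "\<And>n. dist (fst (p n)) z < inverse (real (Suc n))" by metis
    \<comment> \<open>At coordinate \<open>i\<close> only the parameters with index
      \<open>n \<le> i\<close> may exceed \<open>s i\<close>. Adding their maximum to the bound puts
      the whole sequence into one compact box.\<close>
    define B where "B i = {..max (s i) (Max ((\<lambda>n. snd (p n) i) ` {..i}))}" for i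
    have "compactin (product_topology (\<lambda>i. euclidean) UNIV) (PiE UNIV B)"
      unfolding compactin_PiE by (auto simp: B_def intro!: finite_imp_compact)
    then have "compact (PiE UNIV B)"
      by (simp add: euclidean_product_topology)
    then have "seq_compact (PiE UNIV B)" by (rule compact_imp_seq_compact)
    moreover have "\<forall>n. snd (p n) \<in> PiE UNIV B"
    proof (intro allI PiE_I)
      fix n i
      show "snd (p n) i \<in> B i"
      proof (cases "i < n")
        case True then show ?thesis using p(2) by (auto simp: B_def le_max_iff_disj)
      next
        case False
        then have "snd (p n) i \<le> Max ((\<lambda>n. snd (p n) i) ` {..i})" by (intro Max_ge) auto
        then show ?thesis by (auto simp: B_def)
      qed
    qed auto
    ultimately obtain \<sigma> r where r: "strict_mono (r :: nat \<Rightarrow> nat)" "((\<lambda>n. snd (p n)) \<circ> r) \<longlonglongrightarrow> \<sigma>"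
      unfolding seq_compact_def by metis
    have "(\<lambda>n. fst (p n)) \<longlonglongrightarrow> z"
      unfolding tendsto_dist_iff[of _ z]
      by (rule tendsto_sandwich[OF _ _ tendsto_const LIMSEQ_inverse_real_of_nat])
        (auto intro!: always_eventually less_imp_le p(3) simp del: of_nat_Suc)
    then have "((\<lambda>n. fst (p n)) \<circ> r) \<longlonglongrightarrow> z" by (rule LIMSEQ_subseq_LIMSEQ[OF _ r(1)])
    then have "(\<lambda>n. (fst (p (r n)), snd (p (r n)))) \<longlonglongrightarrow> (z, \<sigma>)"
      using r(2) by (intro tendsto_Pair) (auto simp: comp_def)
    then have "(z, \<sigma>) \<in> C"
      by (rule closed_sequentially[OF C(1), rotated]) (simp add: p(1))
    then show ?thesis using C(2) by force
  qed
  moreover have "decseq K"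
  proof (rule decseq_SucI)
    fix n show "K (Suc n) \<subseteq> K n"
      unfolding K_def F_eq by (intro closure_mono) auto
  qed
  moreover have "V (K n)" for n
    using mono[OF closure_subset f(1)[of n]] by (simp add: K_def)
  moreover have "K n \<subseteq> closure E" for n
    unfolding K_def by (intro closure_mono FE)
  ultimately show ?thesis by (intro that[of K]) (auto simp: K_def)
qed

subsection \<open>Schoenberg's space-filling curve\<close>

text \<open>A continuous 2-periodic function, equal to 0 within \<open>1/3\<close> of the even integers and to 1 within
  \<open>1/3\<close> of the odd ones: it reads off ternary digits \<open>0\<close> and \<open>2\<close> continuously (Schoenberg).\<close>

definition schoenberg :: "real \<Rightarrow> real" where
  "schoenberg t = max 0 (min 1 (1 / 2 - cos (pi * t)))"

text \<open>A point of the Cantor set; the gaps of that set are what allow a continuous function to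
  recover the digits exactly.\<close>

definition ternary :: "(nat \<Rightarrow> bool) \<Rightarrow> real" where
  "ternary b = (\<Sum>k. 2 * of_bool (b k) / 3 ^ Suc k)"

lemma schoenberg_continuous: "continuous_on S schoenberg"
  unfolding schoenberg_def by (intro continuous_intros)

lemma schoenberg_bounds: "0 \<le> schoenberg t" "schoenberg t \<le> 1"
  by (auto simp: schoenberg_def)

lemma schoenberg_even_shift: "schoenberg (2 * real n + t) = schoenberg t"
proof -
  have "pi * (2 * real n + t) = pi * t + 2 * pi * real n" by (simp add: algebra_simps)
  then have "cos (pi * (2 * real n + t)) = cos (pi * t)"
    using sin_cos_eq_iff[of "pi * (2 * real n + t)" "pi * t"]
    by (metis Ints_of_nat of_int_of_nat_eq sin_cos_eq_iff)
  then show ?thesis by (simp add: schoenberg_def)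
qed

lemma schoenberg_digit:
  assumes "0 \<le> t" "t \<le> 1 / 3"
  shows "schoenberg t = 0" "schoenberg (2 / 3 + t) = 1"
proof -
  have "cos (pi / 3) \<le> cos (pi * t)"
    using assms by (intro cos_monotone_0_pi_le) auto
  then show "schoenberg t = 0" by (simp add: schoenberg_def cos_60)
  have "cos (pi * (2 / 3 + t)) \<le> cos (pi * (2 / 3))"
    using assms mult_left_mono[of "2 / 3 + t" 1 pi] by (intro cos_monotone_0_pi_le mult_left_mono) auto
  also have "cos (pi * (2 / 3)) = - (1 / 2)"
    using cos_120 by (simp add: mult.commute)
  finally show "schoenberg (2 / 3 + t) = 1" by (simp add: schoenberg_def)
qed

lemma summable_ternary: "summable (\<lambda>k. 2 * of_bool (b k) / 3 ^ Suc k :: real)"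
proof (rule summable_comparison_test')
  show "summable (\<lambda>k. (1 / 3) ^ k :: real)" by (intro summable_geometric) simp
  show "norm (2 * of_bool (b k) / 3 ^ Suc k :: real) \<le> (1 / 3) ^ k" for k
    by (auto simp: power_one_over field_simps)
qed

lemma ternary_bounds: "0 \<le> ternary b" "ternary b \<le> 1"
proof -
  show "0 \<le> ternary b" unfolding ternary_def by (intro suminf_nonneg summable_ternary) simp
  have "(\<lambda>k. 2 / 3 * (1 / 3) ^ k :: real) sums (2 / 3 * (1 / (1 - 1 / 3)))"
    by (intro sums_mult geometric_sums) simp
  then have s: "(\<lambda>k. 2 / 3 * (1 / 3) ^ k :: real) sums 1" by simp
  have "ternary b \<le> (\<Sum>k. 2 / 3 * (1 / 3) ^ k)"
    unfolding ternary_def using s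
    by (intro suminf_le summable_ternary) (auto simp: power_one_over sums_iff)
  then show "ternary b \<le> 1" using s by (simp add: sums_iff)
qed

lemma ternary_shift: "3 * ternary b = 2 * of_bool (b 0) + ternary (\<lambda>k. b (Suc k))"
proof -
  have "ternary b = 2 * of_bool (b 0) / 3 + (\<Sum>k. 2 * of_bool (b (Suc k)) / 3 ^ Suc (Suc k))"
    unfolding ternary_def using suminf_split_head[OF summable_ternary[of b]] by simp
  also have "(\<Sum>k. 2 * of_bool (b (Suc k)) / 3 ^ Suc (Suc k)) = (\<Sum>k. (2 * of_bool (b (Suc k)) / 3 ^ Suc k) / 3 :: real)"
    by (intro suminf_cong) simp
  also have "\<dots> = ternary (\<lambda>k. b (Suc k)) / 3"
    unfolding ternary_def by (intro suminf_divide summable_ternary)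
  finally show ?thesis by simp
qed

text \<open>Multiplication by \<open>3 ^ k\<close> shifts the digits. The integer split off is even
  because all digits are 0 or 2, so periodicity removes it and the new leading digit decides the
  value.\<close>

lemma schoenberg_ternary: "schoenberg (3 ^ k * ternary b) = of_bool (b k)"
proof -
  have "\<exists>n::nat. 3 ^ k * ternary b = 2 * real n + ternary (\<lambda>i. b (k + i))"
  proof (induction k)
    case (Suc k)
    then obtain n where "3 ^ k * ternary b = 2 * real n + ternary (\<lambda>i. b (k + i))" ..
    then have "3 ^ Suc k * ternary b = 3 * (2 * real n) + 3 * ternary (\<lambda>i. b (k + i))" by simp
    also have "\<dots> = 2 * real (3 * n + of_bool (b k)) + ternary (\<lambda>i. b (Suc k + i))"
      by (simp add: ternary_shift[of "\<lambda>i. b (k + i)"])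
    finally show ?case ..
  qed (auto intro: exI[of _ 0])
  then obtain n :: nat where n: "3 ^ k * ternary b = 2 * real n + ternary (\<lambda>i. b (k + i))" ..
  define t where "t = ternary (\<lambda>i. b (Suc k + i))"
  have "3 * ternary (\<lambda>i. b (k + i)) = 2 * of_bool (b k) + t"
    using ternary_shift[of "\<lambda>i. b (k + i)"] by (simp add: t_def)
  then have "3 ^ k * ternary b = 2 * real n + (2 * of_bool (b k) / 3 + t / 3)" using n by simp
  then have "schoenberg (3 ^ k * ternary b) = schoenberg (2 * of_bool (b k) / 3 + t / 3)"
    by (simp only: schoenberg_even_shift)
  then show ?thesis
    using schoenberg_digit[of "t / 3"] ternary_bounds[of "\<lambda>i. b (Suc k + i)"] by (cases "b k") (auto simp: t_def)
qed

text \<open>Coordinate \<open>j\<close> of a space-filling curve: \<open>prod_encode\<close>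
  distributes the digits of one parameter among countably many binary expansions.\<close>

definition schoenberg_curve :: "nat \<Rightarrow> real \<Rightarrow> real" where
  "schoenberg_curve j t = (\<Sum>k. schoenberg (3 ^ prod_encode (j, k) * t) / 2 ^ Suc k)"

lemma schoenberg_curve_continuous: "continuous_on UNIV (schoenberg_curve j)"
  unfolding schoenberg_curve_def
proof (rule uniform_limit_theorem[OF _ Weierstrass_m_test])
  show "\<forall>\<^sub>F n in sequentially. continuous_on UNIV (\<lambda>t. \<Sum>k<n. schoenberg (3 ^ prod_encode (j, k) * t) / 2 ^ Suc k)"
    by (intro always_eventually allI continuous_intros continuous_on_compose2[OF schoenberg_continuous[of UNIV]]) auto
  show "summable (\<lambda>k. (1 / 2) ^ Suc k :: real)"
    by (subst summable_Suc_iff) (intro summable_geometric, simp)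
  show "norm (schoenberg (3 ^ prod_encode (j, k) * t) / 2 ^ Suc k) \<le> (1 / 2) ^ Suc k" for k t
    using schoenberg_bounds by (simp add: power_one_over divide_right_mono)
qed auto

lemma schoenberg_curve_bounds: "schoenberg_curve j t \<in> {0..1}"
proof -
  have h: "(\<lambda>k. (1 / 2) ^ Suc k :: real) sums 1" by (rule power_half_series)
  have s: "summable (\<lambda>k. schoenberg (3 ^ prod_encode (j, k) * t) / 2 ^ Suc k)"
    using schoenberg_bounds by (intro summable_comparison_test'[OF sums_summable[OF h]])
      (simp add: power_one_over divide_right_mono)
  have "schoenberg_curve j t \<le> (\<Sum>k. (1 / 2) ^ Suc k)"
    unfolding schoenberg_curve_def using schoenberg_bounds h s
    by (intro suminf_le) (auto simp: power_one_over divide_right_mono sums_iff)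
  moreover have "0 \<le> schoenberg_curve j t"
    unfolding schoenberg_curve_def using schoenberg_bounds by (intro suminf_nonneg s) auto
  ultimately show ?thesis using h by (simp add: sums_iff)
qed

lemma binary_expansion:
  fixes x :: real
  assumes "x \<in> {0..1}"
  obtains b :: "nat \<Rightarrow> bool" where "(\<lambda>k. of_bool (b k) / 2 ^ Suc k) sums x"
\<comment> \<open>The endpoint has all digits 1. For \<open>x < 1\<close> the dyadic floors start at
  0, and their increments are the digits.\<close>
proof (cases "x = 1")
  case True
  show ?thesis by (rule that[of "\<lambda>_. True"]) (use power_half_series in \<open>simp add: True power_one_over\<close>)
next
  case False
  define u where "u n = real_of_int \<lfloor>2 ^ n * x\<rfloor> / 2 ^ n" for n
  define b where "b n = odd \<lfloor>2 ^ Suc n * x\<rfloor>" for n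
  have step: "u (Suc n) - u n = of_bool (b n) / 2 ^ Suc n" for n
  proof -
    have "\<lfloor>2 ^ n * x\<rfloor> = \<lfloor>2 ^ Suc n * x\<rfloor> div 2"
      using floor_divide_real_eq_div[of 2 "2 ^ Suc n * x"] by simp
    then have "\<lfloor>2 ^ Suc n * x\<rfloor> = 2 * \<lfloor>2 ^ n * x\<rfloor> + of_bool (b n)"
      unfolding b_def by (auto elim: oddE evenE)
    then have "real_of_int \<lfloor>2 ^ Suc n * x\<rfloor> = 2 * real_of_int \<lfloor>2 ^ n * x\<rfloor> + of_bool (b n)"
      by (metis of_int_add of_int_mult of_int_numeral of_int_of_bool)
    then show ?thesis unfolding u_def by (simp add: field_simps)
  qed
  have "u \<longlonglongrightarrow> x"
  proof (rule tendsto_sandwich[of "\<lambda>n. x - (1 / 2) ^ n" _ _ "\<lambda>_. x"])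
    show "(\<lambda>n. x - (1 / 2) ^ n) \<longlonglongrightarrow> x"
      by (auto intro!: tendsto_eq_intros LIMSEQ_power_zero)
    have "x - (1 / 2) ^ n \<le> u n" "u n \<le> x" for n
    proof -
      have "x - (1 / 2) ^ n = (2 ^ n * x - 1) / 2 ^ n" by (simp add: power_one_over diff_divide_distrib)
      also have "\<dots> \<le> u n" unfolding u_def by (intro divide_right_mono) (linarith | simp)+
      finally show "x - (1 / 2) ^ n \<le> u n" .
      have "u n \<le> (2 ^ n * x) / 2 ^ n" unfolding u_def by (intro divide_right_mono) auto
      then show "u n \<le> x" by simp
    qed
    then show "\<forall>\<^sub>F n in sequentially. x - (1 / 2) ^ n \<le> u n" "\<forall>\<^sub>F n in sequentially. u n \<le> x" by auto
  qed auto
  then have "(\<lambda>n. u (Suc n) - u n) sums (x - u 0)" by (rule telescope_sums)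
  moreover have "u 0 = 0" using assms False by (auto simp: u_def floor_eq_iff)
  ultimately show ?thesis by (intro that[of b]) (simp add: step)
qed

text \<open>The binary digits of all coordinates are interleaved into one Cantor point, from which
  each coordinate function reads its own expansion.\<close>

lemma schoenberg_curve_surj:
  assumes "\<And>j. x j \<in> {0..1}"
  obtains t where "t \<in> {0..1}" "\<And>j. schoenberg_curve j t = x j"
proof -
  have "\<exists>b :: nat \<Rightarrow> bool. (\<lambda>k. of_bool (b k) / 2 ^ Suc k) sums x j" for j
    using binary_expansion[OF assms[of j]] by metis
  then obtain b :: "nat \<Rightarrow> nat \<Rightarrow> bool" where b: "\<And>j. (\<lambda>k. of_bool (b j k) / 2 ^ Suc k) sums x j" by metis
  define t where "t = ternary (\<lambda>i. case prod_decode i of (j, k) \<Rightarrow> b j k)"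
  have "schoenberg_curve j t = x j" for j
    using b[of j] unfolding schoenberg_curve_def t_def schoenberg_ternary by (simp add: sums_iff)
  then show ?thesis using that[of t] ternary_bounds by (simp add: t_def)
qed

subsection \<open>Weak limits of discrete measures\<close>

text \<open>The space-filling curve reduces compactness in the cube to Helly's selection theorem on
  the line: atoms are lifted to parameters in \<open>[0,1]\<close>, a weak limit is taken there, and
  its image under the curve is the desired measure.\<close>

lemma weak_limit_of_atoms:
  fixes w :: "nat \<Rightarrow> 'i \<Rightarrow> real" and z :: "nat \<Rightarrow> 'i \<Rightarrow> real \<times> real \<times> real"
  assumes I: "\<And>n. finite (I n)" and w: "\<And>n i. 0 \<le> w n i" "\<And>n. (\<Sum>i\<in>I n. w n i) \<le> 1"
    and z: "\<And>n i. i \<in> I n \<Longrightarrow> z n i \<in> {0..1} \<times> {0..1} \<times> {0..1}"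
  obtains r \<theta> where "strict_mono (r :: nat \<Rightarrow> nat)" "sets \<theta> = sets borel" "finite_measure \<theta>"
    "\<And>F :: real \<times> real \<times> real \<Rightarrow> real. continuous_on UNIV F \<Longrightarrow> integrable \<theta> F \<and>
      (\<lambda>n. \<Sum>i\<in>I (r n). w (r n) i * F (z (r n) i)) \<longlonglongrightarrow> integral\<^sup>L \<theta> F"
proof -
  define G where "G t = (schoenberg_curve 0 t, schoenberg_curve 1 t, schoenberg_curve 2 t)" for t
  have contG: "continuous_on UNIV G"
    unfolding G_def by (intro continuous_intros schoenberg_curve_continuous)
  have [measurable]: "G \<in> borel_measurable borel"
    by (rule borel_measurable_continuous_onI[OF contG])
  have G01: "G t \<in> {0..1} \<times> {0..1} \<times> {0..1}" for t
    unfolding G_def using schoenberg_curve_bounds by auto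
  have "\<exists>t\<in>{0..1}. G t = v" if "v \<in> {0..1} \<times> {0..1} \<times> {0..1}" for v
  proof -
    obtain a b c where v: "v = (a, b, c)" by (cases v)
    define x :: "nat \<Rightarrow> real" where "x j = (if j = 0 then a else if j = 1 then b else c)" for j
    have 01: "x j \<in> {0..1}" for j using that v by (auto simp: x_def)
    obtain t where "t \<in> {0..1}" "\<And>j. schoenberg_curve j t = x j"
      by (rule schoenberg_curve_surj[of x, OF 01]) blast
    then show ?thesis by (auto simp: G_def v x_def intro!: bexI[of _ t])
  qed
  then obtain lift where lift: "\<And>v. v \<in> {0..1} \<times> {0..1} \<times> {0..1} \<Longrightarrow> lift v \<in> {0..1} \<and> G (lift v) = v"
    by metis
  \<comment> \<open>The missing mass is placed at \<open>-1\<close>, off the parameter interval, and removed by the cut-off \<open>cut\<close>.\<close>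
  define pos where "pos n x = (case x of None \<Rightarrow> -1 | Some i \<Rightarrow> lift (z n i))" for n x
  define wt where "wt n x = (case x of None \<Rightarrow> 1 - (\<Sum>i\<in>I n. w n i) | Some i \<Rightarrow> w n i)" for n x
  define cut :: "real \<Rightarrow> real" where "cut t = max 0 (min 1 (t + 1))" for t
  have cut: "continuous_on UNIV cut" "0 \<le> cut t" "cut t \<le> 1" for t
    unfolding cut_def by (auto intro!: continuous_intros)
  have [measurable]: "cut \<in> borel_measurable borel" by (rule borel_measurable_continuous_onI[OF cut(1)])
  define A where "A n = insert None (Some ` I n)" for n
  have A: "finite (A n)" for n using I by (simp add: A_def)
  have wt0: "0 \<le> wt n x" for n x using w by (auto simp: wt_def split: option.split)
  have sumA: "(\<Sum>x\<in>A n. wt n x * g x) = (1 - (\<Sum>i\<in>I n. w n i)) * g None + (\<Sum>i\<in>I n. w n i * g (Some i))"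
    for n and g :: "'i option \<Rightarrow> real"
    unfolding A_def using I[of n] by (subst sum.insert) (auto simp: wt_def sum.reindex)
  define \<rho> where "\<rho> n = distr (point_measure (A n) (\<lambda>x. ennreal (wt n x))) borel (pos n)" for n
  have pm: "prob_space (point_measure (A n) (\<lambda>x. ennreal (wt n x)))" for n
  proof (rule prob_spaceI)
    have "emeasure (point_measure (A n) (\<lambda>x. ennreal (wt n x))) (A n) = ennreal (\<Sum>x\<in>A n. wt n x)"
      using A wt0 by (subst emeasure_point_measure_finite) (auto simp: sum_ennreal)
    then show "emeasure (point_measure (A n) (\<lambda>x. ennreal (wt n x))) (space (point_measure (A n) (\<lambda>x. ennreal (wt n x)))) = 1"
      using sumA[of n "\<lambda>_. 1"] by (simp add: space_point_measure)
  qed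
  have posm[measurable]: "pos n \<in> point_measure (A n) (\<lambda>x. ennreal (wt n x)) \<rightarrow>\<^sub>M borel" for n
    by (simp add: measurable_def space_point_measure sets_point_measure)
  have \<rho>: "real_distribution (\<rho> n)" for n
    unfolding \<rho>_def by (intro prob_space.real_distribution_distr pm posm)
  have int\<rho>: "integral\<^sup>L (\<rho> n) g = (\<Sum>x\<in>A n. wt n x * g (pos n x))" if [measurable]: "g \<in> borel_measurable borel" for n g
    unfolding \<rho>_def using A wt0 by (simp add: integral_distr lebesgue_integral_point_measure_finite)
  \<comment> \<open>One half-open interval contains \<open>[0,1]\<close> and the extra atom at -1
    for every \<open>n\<close>, which makes tightness immediate.\<close>
  have posr: "x \<in> A n \<Longrightarrow> pos n x \<in> {-2<..1}" for n x
    using lift[OF z] by (fastforce simp: A_def pos_def)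
  have "tight \<rho>"
    unfolding tight_def
  proof (intro conjI allI impI \<rho>)
    fix \<epsilon> :: real assume "0 < \<epsilon>"
    have "measure (\<rho> n) {-2<..1} = 1" for n
    proof -
      interpret real_distribution "\<rho> n" by (rule \<rho>)
      have "AE t in \<rho> n. t \<in> {-2<..1}"
        unfolding \<rho>_def using posr by (subst AE_distr_iff) (auto intro!: AE_I2 simp: space_point_measure)
      then show ?thesis by (simp add: prob_eq_1)
    qed
    then show "\<exists>a b. a < b \<and> (\<forall>n. 1 - \<epsilon> < measure (\<rho> n) {a<..b})"
      using \<open>0 < \<epsilon>\<close> by (intro exI[of _ "-2"] exI[of _ 1]) auto
  qed
  then obtain r M where r: "strict_mono r" and M: "real_distribution M" and wc: "weak_conv_m (\<rho> \<circ> id \<circ> r) M"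
    using tight_imp_convergent_subsubsequence[of \<rho> id] strict_mono_id by blast
  interpret M: real_distribution M by (rule M)
  define \<theta> where "\<theta> = distr (density M (\<lambda>t. ennreal (cut t))) borel G"
  have "(\<integral>\<^sup>+t. ennreal (cut t) \<partial>M) \<le> (\<integral>\<^sup>+t. 1 \<partial>M)"
    using cut(3) by (intro nn_integral_mono) simp
  then have "emeasure (density M (\<lambda>t. ennreal (cut t))) (space M) \<le> 1"
    using M.emeasure_space_1 by (simp add: emeasure_density)
  then have "finite_measure (density M (\<lambda>t. ennreal (cut t)))"
    by (intro finite_measureI) (auto simp: top_unique)
  then have fin: "finite_measure \<theta>" unfolding \<theta>_def by (rule finite_measure.finite_measure_distr) simp
  have "integrable \<theta> F \<and> (\<lambda>n. \<Sum>i\<in>I (r n). w (r n) i * F (z (r n) i)) \<longlonglongrightarrow> integral\<^sup>L \<theta> F"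
    if F: "continuous_on UNIV F" for F :: "real \<times> real \<times> real \<Rightarrow> real"
  proof -
    have [measurable]: "F \<in> borel_measurable borel" by (rule borel_measurable_continuous_onI[OF F])
    have "compact (F ` ({0..1} \<times> {0..1} \<times> {0..1}))"
      by (intro compact_continuous_image continuous_on_subset[OF F] compact_Times compact_Icc) auto
    then obtain B where B: "\<And>v. v \<in> {0..1} \<times> {0..1} \<times> {0..1} \<Longrightarrow> norm (F v) \<le> B"
      using compact_imp_bounded bounded_iff by (metis image_eqI)
    have b: "norm (cut t * F (G t)) \<le> B" for t
      using cut(2,3)[of t] B[OF G01[of t]] mult_mono[of "cut t" 1 "\<bar>F (G t)\<bar>" B] by (simp add: abs_mult)
    have c: "isCont (\<lambda>t. cut t * F (G t)) t" for t
    proof -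
      have "continuous_on UNIV (\<lambda>t. cut t * F (G t))"
        by (intro continuous_on_mult cut continuous_on_compose2[OF F contG]) auto
      then show ?thesis by (simp add: continuous_on_eq_continuous_at)
    qed
    have "(\<lambda>n. integral\<^sup>L ((\<rho> \<circ> id \<circ> r) n) (\<lambda>t. cut t * F (G t))) \<longlonglongrightarrow> integral\<^sup>L M (\<lambda>t. cut t * F (G t))"
      using \<rho> by (intro weak_conv_imp_integral_bdd_continuous_conv[OF _ M wc c b]) simp
    moreover have "integral\<^sup>L ((\<rho> \<circ> id \<circ> r) n) (\<lambda>t. cut t * F (G t)) = (\<Sum>i\<in>I (r n). w (r n) i * F (z (r n) i))" for n
    proof -
      have "w (r n) i * (cut (pos (r n) (Some i)) * F (G (pos (r n) (Some i)))) = w (r n) i * F (z (r n) i)"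
        if "i \<in> I (r n)" for i
        using lift[OF z[OF that]] by (simp add: pos_def cut_def)
      then have "(\<Sum>i\<in>I (r n). w (r n) i * (cut (pos (r n) (Some i)) * F (G (pos (r n) (Some i)))))
          = (\<Sum>i\<in>I (r n). w (r n) i * F (z (r n) i))"
        by (intro sum.cong refl)
      moreover have "cut (pos (r n) None) = 0" by (simp add: pos_def cut_def)
      ultimately show ?thesis by (simp add: int\<rho> sumA)
    qed
    moreover have "integral\<^sup>L \<theta> F = integral\<^sup>L M (\<lambda>t. cut t * F (G t))"
      unfolding \<theta>_def using cut by (simp add: integral_distr integral_density)
    moreover have "integrable \<theta> F"
    proof -
      interpret finite_measure \<theta> by (rule fin)
      have "AE v in \<theta>. norm (F v) \<le> B"
        unfolding \<theta>_def using B[OF G01] by (subst AE_distr_iff) auto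
      then show ?thesis by (intro integrable_const_bound[where B = B]) (auto simp: \<theta>_def)
    qed
    ultimately show ?thesis by simp
  qed
  then show ?thesis using r fin by (intro that[of r \<theta>]) (auto simp: \<theta>_def)
qed

text \<open>The indicator of a closed set is the limit of the Lipschitz functions
  \<open>max 0 (1 - k * infdist x C)\<close>; inner regularity carries the inequality from compact
  sets to Borel sets.\<close>

lemma measure_le_if_lipschitz_integral_le:
  fixes \<alpha> \<beta> :: "'a::polish_space measure"
  assumes fin: "finite_measure \<alpha>" "finite_measure \<beta>" and sets: "sets \<alpha> = sets borel" "sets \<beta> = sets borel"
    and le: "\<And>f k. (\<And>x. f x \<in> {0..1}) \<Longrightarrow> (\<And>x y. \<bar>f x - f y\<bar> \<le> real k * dist x y) \<Longrightarrow>
      integral\<^sup>L \<alpha> f \<le> integral\<^sup>L \<beta> f"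
    and A: "A \<in> sets borel"
  shows "emeasure \<alpha> A \<le> emeasure \<beta> A"
proof -
  interpret \<alpha>: finite_measure \<alpha> by fact
  interpret \<beta>: finite_measure \<beta> by fact
  note [measurable_cong] = sets
  have closed_le: "emeasure \<alpha> C \<le> emeasure \<beta> C" if C: "closed C" for C
  \<comment> \<open>\<open>infdist\<close> to the empty set is 0 by convention, so the approximating
    functions would not converge to its indicator.\<close>
  proof (cases "C = {}")
    case False
    have Cb[measurable]: "C \<in> sets borel" using C by simp
    define f where "f k x = max 0 (1 - real k * infdist x C)" for k x
    have f01: "f k x \<in> {0..1}" for k x using infdist_nonneg[of x C] by (auto simp: f_def)
    have lip: "\<bar>f k x - f k y\<bar> \<le> real k * dist x y" for k x y
    proof -
      have "\<bar>f k x - f k y\<bar> \<le> \<bar>real k * infdist x C - real k * infdist y C\<bar>" by (auto simp: f_def)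
      also have "\<dots> = real k * \<bar>infdist x C - infdist y C\<bar>" by (simp add: abs_mult flip: right_diff_distrib)
      also have "\<dots> \<le> real k * dist x y"
        using infdist_triangle_abs[of x C y] by (intro mult_left_mono) auto
      finally show ?thesis .
    qed
    have [measurable]: "f k \<in> borel_measurable borel" for k
      unfolding f_def by (intro borel_measurable_continuous_onI continuous_intros)
    have lim: "(\<lambda>k. f k x) \<longlonglongrightarrow> indicator C x" for x
    proof (cases "x \<in> C")
      case False
      then have "0 < infdist x C"
        using in_closed_iff_infdist_zero[OF C \<open>C \<noteq> {}\<close>, of x] infdist_nonneg[of x C] by (auto simp: less_le)
      then obtain n where n: "1 < real n * infdist x C" using reals_Archimedean3 by blast
      have "f k x = 0" if "n \<le> k" for k
        using n mult_right_mono[of "real n" "real k" "infdist x C"] that infdist_nonneg[of x C] by (auto simp: f_def)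
      then show ?thesis using False
        by (intro tendsto_eventually) (auto simp: eventually_sequentially)
    qed (simp add: f_def)
    have "(\<lambda>k. integral\<^sup>L \<alpha> (f k)) \<longlonglongrightarrow> integral\<^sup>L \<alpha> (indicator C)"
      by (rule integral_dominated_convergence[where w = "\<lambda>_. 1"]) (use f01 lim in auto)
    moreover have "(\<lambda>k. integral\<^sup>L \<beta> (f k)) \<longlonglongrightarrow> integral\<^sup>L \<beta> (indicator C)"
      by (rule integral_dominated_convergence[where w = "\<lambda>_. 1"]) (use f01 lim in auto)
    ultimately have "integral\<^sup>L \<alpha> (indicator C) \<le> (integral\<^sup>L \<beta> (indicator C) :: real)"
      by (rule LIMSEQ_le) (use le[OF f01 lip] in auto)
    then show ?thesis
      using sets_eq_imp_space_eq[OF sets(1)] sets_eq_imp_space_eq[OF sets(2)]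
      by (simp add: \<alpha>.emeasure_eq_measure \<beta>.emeasure_eq_measure)
  qed simp
  have "emeasure \<alpha> A = (SUP K\<in>{K. K \<subseteq> A \<and> compact K}. emeasure \<alpha> K)"
    using sets(1) A by (intro inner_regular) (auto simp: \<alpha>.emeasure_eq_measure)
  also have "\<dots> \<le> emeasure \<beta> A"
  proof (rule SUP_least)
    fix K assume "K \<in> {K. K \<subseteq> A \<and> compact K}"
    then have "emeasure \<alpha> K \<le> emeasure \<beta> K" "emeasure \<beta> K \<le> emeasure \<beta> A"
      using A sets(2) by (auto intro!: closed_le compact_imp_closed emeasure_mono)
    then show "emeasure \<alpha> K \<le> emeasure \<beta> A" by (rule order_trans)
  qed
  finally show ?thesis .
qed

subsection \<open>Transport on the unit interval\<close>

text \<open>Defined on the whole line: \<open>nat\<close> sends negative arguments to cell 0 and the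
  minimum sends large ones to cell \<open>N\<close>. The point 1 has cell \<open>N\<close>, which
  makes \<open>N + 1\<close> cells.\<close>

definition grid_cell :: "nat \<Rightarrow> real \<Rightarrow> nat" where
  "grid_cell N x = min N (nat \<lfloor>real N * x\<rfloor>)"

lemma grid_cell_le: "grid_cell N x \<le> N"
  by (simp add: grid_cell_def)

lemma grid_cell_measurable[measurable]: "grid_cell N \<in> borel \<rightarrow>\<^sub>M count_space UNIV"
  unfolding grid_cell_def by measurable

lemma grid_cell_approx:
  assumes "0 < N" "x \<in> {0..1}"
  shows "\<bar>x - real (grid_cell N x) / real N\<bar> \<le> 1 / real N"
proof -
  have "\<lfloor>real N * x\<rfloor> \<le> \<lfloor>real N\<rfloor>"
    using assms by (intro floor_mono) (simp add: mult_left_le)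
  then have "real (grid_cell N x) = real_of_int \<lfloor>real N * x\<rfloor>"
    using assms by (auto simp: grid_cell_def min_def le_nat_iff nat_le_iff)
  moreover have "\<bar>real N * x - real_of_int \<lfloor>real N * x\<rfloor>\<bar> \<le> 1" by linarith
  moreover have "x - real_of_int \<lfloor>real N * x\<rfloor> / real N = (real N * x - real_of_int \<lfloor>real N * x\<rfloor>) / real N"
    using assms by (simp add: field_simps)
  ultimately show ?thesis using assms by (simp add: divide_right_mono)
qed

lemma integral_grid_cell:
  fixes g :: "nat \<Rightarrow> real"
  assumes "prob_space \<mu>" "sets \<mu> = sets borel"
  shows "integrable \<mu> (\<lambda>x. g (grid_cell N x))"
    "(\<integral>x. g (grid_cell N x) \<partial>\<mu>) = (\<Sum>i\<le>N. g i * measure \<mu> {x. grid_cell N x = i})"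
proof -
  interpret prob_space \<mu> by fact
  note [measurable_cong] = assms(2)
  have sp: "space \<mu> = UNIV" using sets_eq_imp_space_eq[OF assms(2)] by simp
  have ms: "{x. grid_cell N x = i} \<in> sets \<mu>" for i
  proof -
    have "{x \<in> space borel. grid_cell N x = i} \<in> sets borel" by measurable
    then show ?thesis by (simp add: assms(2))
  qed
  have eq: "g (grid_cell N x) = (\<Sum>i\<le>N. g i * indicator {x. grid_cell N x = i} x)" for x
    using grid_cell_le[of N x] by (simp add: indicator_def)
  have int: "integrable \<mu> (\<lambda>x. g i * indicator {x. grid_cell N x = i} x)" for i
    using ms by (intro integrable_mult_right integrable_real_indicator) (simp_all add: emeasure_eq_measure)
  show "integrable \<mu> (\<lambda>x. g (grid_cell N x))"
    unfolding eq using int by (intro Bochner_Integration.integrable_sum) auto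
  show "(\<integral>x. g (grid_cell N x) \<partial>\<mu>) = (\<Sum>i\<le>N. g i * measure \<mu> {x. grid_cell N x = i})"
    unfolding eq using int ms by (subst Bochner_Integration.integral_sum) (auto simp: sp)
qed

text \<open>Only the masses of the cells are comparable, so both the atoms and \<open>\<mu>\<close>
  are moved to grid points. Each move changes the integral of \<open>f\<close> by at most
  \<open>k / N\<close>, whence the factor 2.\<close>

lemma grid_marginal_lipschitz_bound:
  fixes f :: "real \<Rightarrow> real" and w :: "'i \<Rightarrow> real"
  assumes \<mu>: "prob_space \<mu>" "sets \<mu> = sets borel" and supp: "AE x in \<mu>. x \<in> {0..1}" and N: "0 < N"
    and f: "\<And>x. f x \<in> {0..1}" "\<And>x y. \<bar>f x - f y\<bar> \<le> real k * dist x y"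
    and S: "finite S" "\<And>s. s \<in> S \<Longrightarrow> 0 \<le> w s" "(\<Sum>s\<in>S. w s) \<le> 1" "\<And>s. s \<in> S \<Longrightarrow> x s \<in> {0..1}"
    and cell: "\<And>i. i \<le> N \<Longrightarrow> (\<Sum>s\<in>{s\<in>S. grid_cell N (x s) = i}. w s) \<le> measure \<mu> {x. grid_cell N x = i}"
  shows "(\<Sum>s\<in>S. w s * f (x s)) \<le> integral\<^sup>L \<mu> f + 2 * real k / real N"
proof -
  interpret prob_space \<mu> by fact
  note [measurable_cong] = \<mu>(2)
  define g where "g i = f (real i / real N)" for i
  have near: "\<bar>f y - g (grid_cell N y)\<bar> \<le> real k / real N" if "y \<in> {0..1}" for y
  proof -
    have "\<bar>f y - g (grid_cell N y)\<bar> \<le> real k * dist y (real (grid_cell N y) / real N)"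
      unfolding g_def by (rule f)
    also have "\<dots> \<le> real k * (1 / real N)"
      using grid_cell_approx[OF N that] by (intro mult_left_mono) (auto simp: dist_real_def)
    finally show ?thesis by simp
  qed
  have "(\<Sum>s\<in>S. w s * f (x s)) \<le> (\<Sum>s\<in>S. w s * g (grid_cell N (x s)) + w s * (real k / real N))"
  proof (rule sum_mono)
    fix s assume s: "s \<in> S"
    have "f (x s) \<le> g (grid_cell N (x s)) + real k / real N" using near[OF S(4)[OF s]] by linarith
    then show "w s * f (x s) \<le> w s * g (grid_cell N (x s)) + w s * (real k / real N)"
      using mult_left_mono[OF _ S(2)[OF s]] unfolding distrib_left[symmetric] by blast
  qed
  also have "\<dots> = (\<Sum>s\<in>S. w s * g (grid_cell N (x s))) + (\<Sum>s\<in>S. w s) * (real k / real N)"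
    by (simp only: sum.distrib sum_distrib_right)
  also have "\<dots> \<le> (\<Sum>s\<in>S. w s * g (grid_cell N (x s))) + 1 * (real k / real N)"
    using S(3) by (intro add_left_mono mult_right_mono) auto
  also have "(\<Sum>s\<in>S. w s * g (grid_cell N (x s))) = (\<Sum>i\<le>N. \<Sum>s\<in>{s\<in>S. grid_cell N (x s) = i}. w s * g (grid_cell N (x s)))"
    using S(1) grid_cell_le by (intro sum.group[symmetric]) auto
  also have "\<dots> = (\<Sum>i\<le>N. g i * (\<Sum>s\<in>{s\<in>S. grid_cell N (x s) = i}. w s))"
    by (intro sum.cong) (auto simp: sum_distrib_left mult.commute)
  also have "\<dots> \<le> (\<Sum>i\<le>N. g i * measure \<mu> {x. grid_cell N x = i})"
    using f(1) by (intro sum_mono mult_left_mono cell) (auto simp: g_def)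
  also have "\<dots> = (\<integral>y. g (grid_cell N y) \<partial>\<mu>)" by (rule integral_grid_cell(2)[OF \<mu>, symmetric])
  finally have main: "(\<Sum>s\<in>S. w s * f (x s)) \<le> (\<integral>y. g (grid_cell N y) \<partial>\<mu>) + real k / real N" by simp
  have "continuous_on UNIV f"
    unfolding continuous_on_iff
  proof (intro ballI allI impI)
    fix x :: real and e :: real assume "0 < e"
    then show "\<exists>d>0. \<forall>x'\<in>UNIV. dist x' x < d \<longrightarrow> dist (f x') (f x) < e"
    proof (intro exI[of _ "e / (real k + 1)"] conjI ballI impI)
      fix x' assume "dist x' x < e / (real k + 1)"
      then have "(real k + 1) * dist x' x < e" by (simp add: field_simps)
      moreover have "dist (f x') (f x) \<le> real k * dist x' x" using f(2)[of x' x] by (simp add: dist_real_def)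
      moreover have "real k * dist x' x \<le> (real k + 1) * dist x' x" by (intro mult_right_mono) auto
      ultimately show "dist (f x') (f x) < e" by linarith
    qed simp
  qed
  then have [measurable]: "f \<in> borel_measurable borel" by (rule borel_measurable_continuous_onI)
  have intf: "integrable \<mu> f" using f(1) by (intro integrable_const_bound[where B = 1]) auto
  have "(\<integral>y. g (grid_cell N y) \<partial>\<mu>) \<le> (\<integral>y. f y + real k / real N \<partial>\<mu>)"
  proof (intro integral_mono_AE integral_grid_cell(1)[OF \<mu>] Bochner_Integration.integrable_add intf)
    show "AE y in \<mu>. g (grid_cell N y) \<le> f y + real k / real N"
      using supp
    proof eventually_elim
      case (elim y)
      then show ?case using near[of y] by linarith
    qed
  qed
  also have "\<dots> = integral\<^sup>L \<mu> f + real k / real N" using intf by (simp add: prob_space)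
  finally show ?thesis using main by simp
qed

text \<open>The largest heights of \<open>K\<close> over pairs of cells define a finite problem. Its
  dual solution, extended as step functions, covers \<open>K\<close> up to an error
  \<open>1 / N\<close>; since no cover costs at most \<open>L\<close>, the finite plan gains nearly
  \<open>L\<close>. Its mass is then placed at points of \<open>K\<close>.\<close>

lemma discrete_transport:
  fixes \<mu> \<nu> :: "real measure"
  assumes \<mu>: "prob_space \<mu>" "sets \<mu> = sets borel" "AE x in \<mu>. x \<in> {0..1}"
    and \<nu>: "prob_space \<nu>" "sets \<nu> = sets borel" "AE y in \<nu>. y \<in> {0..1}"
    and K: "K \<subseteq> {0..1} \<times> {0..1} \<times> {0..1}" "cover_pairs \<mu> \<nu> K L = {}" and N: "0 < N"
  obtains I :: "(nat \<times> nat) set" and w z where "finite I" "\<And>i. 0 \<le> w i" "(\<Sum>i\<in>I. w i) \<le> 1" "\<And>i. i \<in> I \<Longrightarrow> z i \<in> K"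
    "L - 2 / real N \<le> (\<Sum>i\<in>I. w i * snd (snd (z i)))"
    "\<And>f k. (\<And>x. f x \<in> {0..1}) \<Longrightarrow> (\<And>x y. \<bar>f x - f y\<bar> \<le> real k * dist x y) \<Longrightarrow>
       (\<Sum>i\<in>I. w i * f (fst (z i))) \<le> integral\<^sup>L \<mu> f + 2 * real k / real N"
    "\<And>f k. (\<And>x. f x \<in> {0..1}) \<Longrightarrow> (\<And>x y. \<bar>f x - f y\<bar> \<le> real k * dist x y) \<Longrightarrow>
       (\<Sum>i\<in>I. w i * f (fst (snd (z i)))) \<le> integral\<^sup>L \<nu> f + 2 * real k / real N"
proof -
  interpret \<mu>: prob_space \<mu> by fact
  interpret \<nu>: prob_space \<nu> by fact
  note [measurable_cong] = \<mu>(2) \<nu>(2)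
  define m where "m i = measure \<mu> {x. grid_cell N x = i}" for i
  define n where "n i = measure \<nu> {x. grid_cell N x = i}" for i
  \<comment> \<open>The inserted 0 gives the supremum a value on pairs of cells that
    \<open>K\<close> does not meet.\<close>
  define T where "T i j = insert 0 {t. \<exists>x y. (x, y, t) \<in> K \<and> grid_cell N x = i \<and> grid_cell N y = j}" for i j
  define h where "h i j = Sup (T i j)" for i j
  have T01: "t \<in> {0..1}" if "t \<in> T i j" for t i j using that K(1) by (auto simp: T_def)
  have bdd: "bdd_above (T i j)" for i j using T01 by (intro bdd_aboveI[of _ 1]) auto
  have Tne: "T i j \<noteq> {}" for i j by (simp add: T_def)
  have Th: "t \<le> h i j" if "t \<in> T i j" for t i j unfolding h_def using that bdd by (rule cSup_upper)
  have h0: "0 \<le> h i j" for i j by (rule Th) (simp add: T_def)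
  have h1: "h i j \<le> 1" for i j
    unfolding h_def using T01 by (intro cSup_least) (auto simp: T_def)
  define \<epsilon> where "\<epsilon> = 1 / real N"
  have \<epsilon>: "0 < \<epsilon>" using N by (simp add: \<epsilon>_def)
  have m0: "0 \<le> m i" "m i \<le> 1" "0 \<le> n i" for i by (auto simp: m_def n_def)
  obtain a b p where ab: "\<And>i. 0 \<le> a i" "\<And>i. a i \<le> 1" "\<And>j. 0 \<le> b j" "\<And>j. b j \<le> 1" "\<And>i j. 0 \<le> p i j"
    and row: "\<And>i. i \<in> {..N} \<Longrightarrow> (\<Sum>j\<in>{..N}. p i j) \<le> m i"
    and col: "\<And>j. j \<in> {..N} \<Longrightarrow> (\<Sum>i\<in>{..N}. p i j) \<le> n j"
    and hab: "\<And>i j. h i j \<le> a i + b j + \<epsilon> * p i j"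
    and dual: "(\<Sum>i\<in>{..N}. a i * m i) + (\<Sum>j\<in>{..N}. b j * n j) \<le> (\<Sum>i\<in>{..N}. \<Sum>j\<in>{..N}. h i j * p i j)"
    apply (rule finite_transport_penalty[of "{..N}" "{..N}" m n h \<epsilon>,
          OF finite_atMost finite_atMost m0(1) m0(3) h0 h1 \<epsilon>])
    subgoal premises prems by (rule prems(1)) (fact prems)+
    done
  \<comment> \<open>A positive supremum is approached by heights of actual points of
    \<open>K\<close>. Pairs with \<open>h = 0\<close> add nothing to the gain and are
    dropped.\<close>
  define I where "I = {ij \<in> {..N} \<times> {..N}. 0 < h (fst ij) (snd ij)}"
  have I: "finite I" "I \<subseteq> {..N} \<times> {..N}" by (auto simp: I_def)
  define w where "w ij = p (fst ij) (snd ij)" for ij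
  have w0: "0 \<le> w ij" for ij by (simp add: w_def ab)
  have "\<exists>v. v \<in> K \<and> grid_cell N (fst v) = fst ij \<and> grid_cell N (fst (snd v)) = snd ij \<and>
      h (fst ij) (snd ij) - \<epsilon> \<le> snd (snd v)" if "ij \<in> I" for ij
  proof -
    have "max 0 (h (fst ij) (snd ij) - \<epsilon>) < h (fst ij) (snd ij)" using that \<epsilon> by (auto simp: I_def)
    then obtain t where t: "t \<in> T (fst ij) (snd ij)" "max 0 (h (fst ij) (snd ij) - \<epsilon>) < t"
      using less_cSupD[OF Tne] unfolding h_def by blast
    then have "t \<noteq> 0" by simp
    with t(1) obtain x y where "(x, y, t) \<in> K" "grid_cell N x = fst ij" "grid_cell N y = snd ij"
      by (auto simp: T_def)
    then show ?thesis using t(2) by (intro exI[of _ "(x, y, t)"]) simp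
  qed
  then obtain z where z: "\<And>ij. ij \<in> I \<Longrightarrow> z ij \<in> K \<and> grid_cell N (fst (z ij)) = fst ij \<and>
      grid_cell N (fst (snd (z ij))) = snd ij \<and> h (fst ij) (snd ij) - \<epsilon> \<le> snd (snd (z ij))"
    by metis
  have sub: "(\<Sum>ij\<in>{ij\<in>I. P ij}. w ij) \<le> (\<Sum>ij\<in>{ij\<in>{..N} \<times> {..N}. P ij}. w ij)" for P
    using I w0 by (intro sum_mono2) auto
  have total: "(\<Sum>ij\<in>I. w ij) \<le> 1"
  proof -
    have "(\<Sum>ij\<in>I. w ij) \<le> (\<Sum>ij\<in>{..N} \<times> {..N}. w ij)" using sub[of "\<lambda>_. True"] by simp
    also have "\<dots> = (\<Sum>i\<le>N. \<Sum>j\<le>N. p i j)" by (simp add: sum.cartesian_product w_def case_prod_beta)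
    also have "\<dots> \<le> (\<Sum>i\<le>N. m i)" by (intro sum_mono row)
    also have "\<dots> = 1" using integral_grid_cell(2)[OF \<mu>(1,2), of "\<lambda>_. 1" N] by (simp add: m_def \<mu>.prob_space)
    finally show ?thesis .
  qed
  have p1: "p i j \<le> 1" if "i \<le> N" "j \<le> N" for i j
  proof -
    have "p i j \<le> (\<Sum>j\<in>{..N}. p i j)" using that ab(5) by (intro member_le_sum) auto
    then show ?thesis using row[of i] m0(2)[of i] that by simp
  qed
  \<comment> \<open>One error \<open>1 / N\<close> comes from raising the potential by
    \<open>\<epsilon>\<close>, the other from choosing points of \<open>K\<close> within
    \<open>\<epsilon>\<close> of the supremum.\<close>
  have gain: "L - 2 / real N \<le> (\<Sum>ij\<in>I. w ij * snd (snd (z ij)))"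
  proof (rule ccontr)
    assume neg: "\<not> ?thesis"
    \<comment> \<open>Since \<open>p \<le> 1\<close> on the grid, adding \<open>\<epsilon>\<close>
      absorbs the penalty slack \<open>\<epsilon> * p\<close>. Capping at 1 keeps the cover because
      heights in \<open>K\<close> are at most 1.\<close>
    define \<phi> where "\<phi> x = min 1 (a (grid_cell N x) + \<epsilon>)" for x
    define \<psi> where "\<psi> y = b (grid_cell N y)" for y
    have "t \<le> \<phi> x + \<psi> y" if "(x, y, t) \<in> K" for x y t
    proof -
      have "t \<le> h (grid_cell N x) (grid_cell N y)" using that by (intro Th) (auto simp: T_def)
      also have "\<dots> \<le> a (grid_cell N x) + b (grid_cell N y) + \<epsilon> * p (grid_cell N x) (grid_cell N y)" by (rule hab)
      also have "\<epsilon> * p (grid_cell N x) (grid_cell N y) \<le> \<epsilon>"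
        using \<epsilon> p1[OF grid_cell_le grid_cell_le] by (simp add: mult_left_le)
      finally have "t \<le> a (grid_cell N x) + \<epsilon> + \<psi> y" by (simp add: \<psi>_def)
      moreover have "t \<le> 1 + \<psi> y" using that K(1) ab(3)[of "grid_cell N y"] by (force simp: \<psi>_def)
      ultimately show ?thesis by (auto simp: \<phi>_def min_def)
    qed
    moreover have "\<phi> x \<in> {0..1}" "\<psi> y \<in> {0..1}" for x y using ab \<epsilon> by (auto simp: \<phi>_def \<psi>_def add_nonneg_nonneg less_imp_le)
    moreover have "\<phi> \<in> borel_measurable \<mu>" "\<psi> \<in> borel_measurable \<nu>" unfolding \<phi>_def \<psi>_def by measurable
    moreover have "integral\<^sup>L \<mu> \<phi> + integral\<^sup>L \<nu> \<psi> \<le> L"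
    proof -
      have "integral\<^sup>L \<mu> \<phi> \<le> (\<integral>x. a (grid_cell N x) + \<epsilon> \<partial>\<mu>)"
        unfolding \<phi>_def using integral_grid_cell(1)[OF \<mu>(1,2), of "\<lambda>i. min 1 (a i + \<epsilon>)" N] integral_grid_cell(1)[OF \<mu>(1,2), of a N]
        by (intro integral_mono) auto
      also have "\<dots> = (\<Sum>i\<le>N. a i * m i) + \<epsilon>"
        using integral_grid_cell[OF \<mu>(1,2), of a N] by (simp add: m_def \<mu>.prob_space)
      finally have 1: "integral\<^sup>L \<mu> \<phi> \<le> (\<Sum>i\<le>N. a i * m i) + \<epsilon>" .
      have 2: "integral\<^sup>L \<nu> \<psi> = (\<Sum>j\<le>N. b j * n j)"
        unfolding \<psi>_def n_def by (rule integral_grid_cell(2)[OF \<nu>(1,2)])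
      have "(\<Sum>i\<le>N. \<Sum>j\<le>N. h i j * p i j) = (\<Sum>ij\<in>{..N} \<times> {..N}. h (fst ij) (snd ij) * w ij)"
        by (simp add: sum.cartesian_product w_def case_prod_beta)
      also have "\<dots> = (\<Sum>ij\<in>I. h (fst ij) (snd ij) * w ij)"
        using h0 by (intro sum.mono_neutral_right) (auto simp: I_def less_le)
      also have "\<dots> \<le> (\<Sum>ij\<in>I. w ij * snd (snd (z ij)) + \<epsilon> * w ij)"
      proof (rule sum_mono)
        fix ij assume "ij \<in> I"
        then have "h (fst ij) (snd ij) \<le> snd (snd (z ij)) + \<epsilon>" using z by fastforce
        from mult_right_mono[OF this w0[of ij]]
        show "h (fst ij) (snd ij) * w ij \<le> w ij * snd (snd (z ij)) + \<epsilon> * w ij" by (simp add: algebra_simps)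
      qed
      also have "\<dots> = (\<Sum>ij\<in>I. w ij * snd (snd (z ij))) + \<epsilon> * (\<Sum>ij\<in>I. w ij)"
        by (simp add: sum.distrib sum_distrib_left)
      also have "\<epsilon> * (\<Sum>ij\<in>I. w ij) \<le> \<epsilon>" using total \<epsilon> by (simp add: mult_left_le)
      finally show ?thesis using 1 2 dual neg by (simp add: \<epsilon>_def)
    qed
    ultimately have "(\<phi>, \<psi>) \<in> cover_pairs \<mu> \<nu> K L" unfolding cover_pairs_def by blast
    then show False using K(2) by simp
  qed
  have zK: "fst (z ij) \<in> {0..1}" "fst (snd (z ij)) \<in> {0..1}" if "ij \<in> I" for ij
    using z[OF that] K(1) by (auto simp: mem_Times_iff)
  \<comment> \<open>Each \<open>z ij\<close> lies over its own pair of cells, so grouping atoms by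
    cell is grouping by row; the dropped pairs only lower the sum.\<close>
  have rows: "(\<Sum>ij\<in>{ij\<in>I. grid_cell N (fst (z ij)) = i}. w ij) \<le> measure \<mu> {x. grid_cell N x = i}" if "i \<le> N" for i
  proof -
    have "{ij\<in>I. grid_cell N (fst (z ij)) = i} = {ij\<in>I. fst ij = i}" using z by auto
    then have "(\<Sum>ij\<in>{ij\<in>I. grid_cell N (fst (z ij)) = i}. w ij) \<le> (\<Sum>ij\<in>{ij\<in>{..N} \<times> {..N}. fst ij = i}. w ij)"
      using sub by simp
    also have "{ij\<in>{..N} \<times> {..N}. fst ij = i} = {i} \<times> {..N}" using that by auto
    also have "(\<Sum>ij\<in>{i} \<times> {..N}. w ij) = (\<Sum>j\<in>{..N}. p i j)"
      by (simp add: w_def case_prod_beta flip: sum.cartesian_product[of "\<lambda>i j. p i j" "{..N}" "{i}", unfolded case_prod_beta])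
    finally show ?thesis using row[of i] that by (simp add: m_def)
  qed
  have cols: "(\<Sum>ij\<in>{ij\<in>I. grid_cell N (fst (snd (z ij))) = j}. w ij) \<le> measure \<nu> {x. grid_cell N x = j}" if "j \<le> N" for j
  proof -
    have "{ij\<in>I. grid_cell N (fst (snd (z ij))) = j} = {ij\<in>I. snd ij = j}" using z by auto
    then have "(\<Sum>ij\<in>{ij\<in>I. grid_cell N (fst (snd (z ij))) = j}. w ij) \<le> (\<Sum>ij\<in>{ij\<in>{..N} \<times> {..N}. snd ij = j}. w ij)"
      using sub by simp
    also have "{ij\<in>{..N} \<times> {..N}. snd ij = j} = {..N} \<times> {j}" using that by auto
    also have "(\<Sum>ij\<in>{..N} \<times> {j}. w ij) = (\<Sum>i\<in>{..N}. p i j)"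
      by (simp add: w_def case_prod_beta flip: sum.cartesian_product[of "\<lambda>i j. p i j" "{j}" "{..N}", unfolded case_prod_beta])
    finally show ?thesis using col[of j] that by (simp add: n_def)
  qed
  show ?thesis
  proof (rule that[OF I(1) w0 total _ gain])
    show "\<And>ij. ij \<in> I \<Longrightarrow> z ij \<in> K" using z by blast
    show "(\<Sum>i\<in>I. w i * f (fst (z i))) \<le> integral\<^sup>L \<mu> f + 2 * real k / real N"
      if "\<And>x. f x \<in> {0..1}" "\<And>x y. \<bar>f x - f y\<bar> \<le> real k * dist x y" for f k
      by (rule grid_marginal_lipschitz_bound[OF \<mu> N that I(1) w0 total zK(1) rows])
    show "(\<Sum>i\<in>I. w i * f (fst (snd (z i)))) \<le> integral\<^sup>L \<nu> f + 2 * real k / real N"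
      if "\<And>x. f x \<in> {0..1}" "\<And>x y. \<bar>f x - f y\<bar> \<le> real k * dist x y" for f k
      by (rule grid_marginal_lipschitz_bound[OF \<nu> N that I(1) w0 total zK(2) cols])
  qed
qed

text \<open>Discrete plans of mesh \<open>1 / (n + 1)\<close> with atoms in \<open>K n\<close> have
  a weak limit along a subsequence. For fixed \<open>m\<close> all late atoms lie in
  \<open>K m\<close>, so the distance to \<open>K m\<close> has integral 0 in the limit; the
  marginal and gain errors vanish.\<close>

lemma compact_transport:
  fixes \<mu> \<nu> :: "real measure"
  assumes \<mu>: "prob_space \<mu>" "sets \<mu> = sets borel" "AE x in \<mu>. x \<in> {0..1}"
    and \<nu>: "prob_space \<nu>" "sets \<nu> = sets borel" "AE y in \<nu>. y \<in> {0..1}"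
    and K: "\<And>n. closed (K n)" "decseq K" "\<And>n. K n \<subseteq> {0..1} \<times> {0..1} \<times> {0..1}"
      "\<And>n. cover_pairs \<mu> \<nu> (K n) L = {}"
    and L: "0 \<le> L"
  obtains \<theta> where "sets \<theta> = sets borel" "finite_measure \<theta>" "AE v in \<theta>. v \<in> (\<Inter>n. K n)"
    "\<And>A. A \<in> sets borel \<Longrightarrow> emeasure (distr \<theta> borel fst) A \<le> emeasure \<mu> A"
    "\<And>B. B \<in> sets borel \<Longrightarrow> emeasure (distr \<theta> borel (\<lambda>v. fst (snd v))) B \<le> emeasure \<nu> B"
    "L \<le> (\<integral>v. snd (snd v) \<partial>\<theta>)"
proof -
  define good where "good n I w z \<longleftrightarrow> finite I \<and> (\<forall>i. 0 \<le> w i) \<and> (\<Sum>i\<in>I. w i) \<le> 1 \<and> (\<forall>i\<in>I. z i \<in> K n) \<and>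
      L - 2 / real (Suc n) \<le> (\<Sum>i\<in>I. w i * snd (snd (z i))) \<and>
      (\<forall>f k. (\<forall>x. f x \<in> {0..1}) \<longrightarrow> (\<forall>x y. \<bar>f x - f y\<bar> \<le> real k * dist x y) \<longrightarrow>
         (\<Sum>i\<in>I. w i * f (fst (z i))) \<le> integral\<^sup>L \<mu> f + 2 * real k / real (Suc n)) \<and>
      (\<forall>f k. (\<forall>x. f x \<in> {0..1}) \<longrightarrow> (\<forall>x y. \<bar>f x - f y\<bar> \<le> real k * dist x y) \<longrightarrow>
         (\<Sum>i\<in>I. w i * f (fst (snd (z i)))) \<le> integral\<^sup>L \<nu> f + 2 * real k / real (Suc n))"
    for n and I :: "(nat \<times> nat) set" and w z
  have "\<exists>I w z. good n I w z" for n
    apply (rule discrete_transport[OF \<mu> \<nu> K(3)[of n] K(4)[of n] zero_less_Suc[of n]])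
    subgoal premises prems for I w z
    proof -
      have "good n I w z"
        unfolding good_def
        by (intro conjI allI impI ballI prems; (elim allE; assumption)?)
      then show ?thesis by blast
    qed
    done
  then obtain I w z where good: "\<And>n. good n (I n) (w n) (z n)" by metis
  have I: "\<And>n. finite (I n)" and w: "\<And>n i. 0 \<le> w n i" "\<And>n. (\<Sum>i\<in>I n. w n i) \<le> 1"
    and z: "\<And>n i. i \<in> I n \<Longrightarrow> z n i \<in> K n"
    and gain: "\<And>n. L - 2 / real (Suc n) \<le> (\<Sum>i\<in>I n. w n i * snd (snd (z n i)))"
    using good unfolding good_def by blast+
  have mf: "(\<Sum>i\<in>I n. w n i * f (fst (z n i))) \<le> integral\<^sup>L \<mu> f + 2 * real k / real (Suc n)"
    and nf: "(\<Sum>i\<in>I n. w n i * f (fst (snd (z n i)))) \<le> integral\<^sup>L \<nu> f + 2 * real k / real (Suc n)"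
    if "\<And>x. f x \<in> {0..1}" "\<And>x y. \<bar>f x - f y\<bar> \<le> real k * dist x y" for n f k
    using good[of n] that unfolding good_def by blast+
  have z01: "z n i \<in> {0..1} \<times> {0..1} \<times> {0..1}" if "i \<in> I n" for n i using z[OF that] K(3) by blast
  obtain r \<theta> where r: "strict_mono r" and \<theta>: "sets \<theta> = sets borel" "finite_measure \<theta>"
    and lim: "\<And>F :: real \<times> real \<times> real \<Rightarrow> real. continuous_on UNIV F \<Longrightarrow> integrable \<theta> F \<and>
      (\<lambda>n. \<Sum>i\<in>I (r n). w (r n) i * F (z (r n) i)) \<longlonglongrightarrow> integral\<^sup>L \<theta> F"
    using weak_limit_of_atoms[of I w z, OF I w z01] by blast
  interpret finite_measure \<theta> by fact
  note [measurable_cong] = \<theta>(1)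
  have [measurable]: "fst \<in> borel_measurable (borel :: (real \<times> real \<times> real) measure)"
    "(\<lambda>v. fst (snd v)) \<in> borel_measurable (borel :: (real \<times> real \<times> real) measure)"
    by (intro borel_measurable_continuous_onI continuous_intros)+
  have small: "(\<lambda>n. c / real (Suc (r n))) \<longlonglongrightarrow> 0" for c
  proof -
    have "(\<lambda>n. c / real (Suc n)) \<longlonglongrightarrow> 0"
      using tendsto_mult_right_zero[OF LIMSEQ_inverse_real_of_nat, of c] by (simp only: divide_inverse)
    then show ?thesis using LIMSEQ_subseq_LIMSEQ[OF _ r] by (simp add: comp_def)
  qed
  have lipc: "continuous_on UNIV f" if "\<And>x y. \<bar>f x - f y\<bar> \<le> real k * dist x y" for f :: "real \<Rightarrow> real" and k
  proof -
    have "k-lipschitz_on UNIV f" using that by (intro lipschitz_onI) (auto simp: dist_real_def)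
    then show ?thesis by (rule lipschitz_on_continuous_on)
  qed
  have A: "emeasure (distr \<theta> borel fst) A \<le> emeasure \<mu> A" if "A \<in> sets borel" for A
  proof (rule measure_le_if_lipschitz_integral_le[OF _ _ _ _ _ that])
    fix f :: "real \<Rightarrow> real" and k
    assume f: "\<And>x. f x \<in> {0..1}" "\<And>x y. \<bar>f x - f y\<bar> \<le> real k * dist x y"
    have c: "continuous_on UNIV f" by (rule lipc[OF f(2)])
    then have [measurable]: "f \<in> borel_measurable borel" by (rule borel_measurable_continuous_onI)
    have "continuous_on UNIV (\<lambda>v::real \<times> real \<times> real. f (fst v))"
      by (intro continuous_on_compose2[OF c] continuous_intros) auto
    from lim[OF this] have "(\<lambda>n. \<Sum>i\<in>I (r n). w (r n) i * f (fst (z (r n) i))) \<longlonglongrightarrow> (\<integral>v. f (fst v) \<partial>\<theta>)" ..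
    moreover have "(\<lambda>n. integral\<^sup>L \<mu> f + 2 * real k / real (Suc (r n))) \<longlonglongrightarrow> integral\<^sup>L \<mu> f + 0"
      by (intro tendsto_add tendsto_const small)
    ultimately have "(\<integral>v. f (fst v) \<partial>\<theta>) \<le> integral\<^sup>L \<mu> f + 0"
      by (rule LIMSEQ_le) (use mf[OF f] in blast)
    then show "integral\<^sup>L (distr \<theta> borel fst) f \<le> integral\<^sup>L \<mu> f" by (simp add: integral_distr)
  qed (use \<mu> in \<open>auto intro: finite_measure_distr prob_space.finite_measure\<close>)
  have B: "emeasure (distr \<theta> borel (\<lambda>v. fst (snd v))) A \<le> emeasure \<nu> A" if "A \<in> sets borel" for A
  proof (rule measure_le_if_lipschitz_integral_le[OF _ _ _ _ _ that])
    fix f :: "real \<Rightarrow> real" and k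
    assume f: "\<And>x. f x \<in> {0..1}" "\<And>x y. \<bar>f x - f y\<bar> \<le> real k * dist x y"
    have c: "continuous_on UNIV f" by (rule lipc[OF f(2)])
    then have [measurable]: "f \<in> borel_measurable borel" by (rule borel_measurable_continuous_onI)
    have "continuous_on UNIV (\<lambda>v::real \<times> real \<times> real. f (fst (snd v)))"
      by (intro continuous_on_compose2[OF c] continuous_intros) auto
    from lim[OF this] have "(\<lambda>n. \<Sum>i\<in>I (r n). w (r n) i * f (fst (snd (z (r n) i)))) \<longlonglongrightarrow> (\<integral>v. f (fst (snd v)) \<partial>\<theta>)" ..
    moreover have "(\<lambda>n. integral\<^sup>L \<nu> f + 2 * real k / real (Suc (r n))) \<longlonglongrightarrow> integral\<^sup>L \<nu> f + 0"
      by (intro tendsto_add tendsto_const small)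
    ultimately have "(\<integral>v. f (fst (snd v)) \<partial>\<theta>) \<le> integral\<^sup>L \<nu> f + 0"
      by (rule LIMSEQ_le) (use nf[OF f] in blast)
    then show "integral\<^sup>L (distr \<theta> borel (\<lambda>v. fst (snd v))) f \<le> integral\<^sup>L \<nu> f" by (simp add: integral_distr)
  qed (use \<nu> in \<open>auto intro: finite_measure_distr prob_space.finite_measure\<close>)
  have "AE v in \<theta>. v \<in> K m" for m
  proof -
    \<comment> \<open>The zero potentials would cover an empty set at cost \<open>0 \<le> L\<close>.
      Nonemptiness lets \<open>infdist\<close> detect membership in \<open>K m\<close>.\<close>
    have "K m \<noteq> {}"
    proof
      assume "K m = {}"
      then have "(\<lambda>_. 0, \<lambda>_. 0) \<in> cover_pairs \<mu> \<nu> (K m) L" using L by (simp add: cover_pairs_def)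
      then show False using K(4) by blast
    qed
    have c: "continuous_on UNIV (\<lambda>v. infdist v (K m))" by (intro continuous_intros)
    have "\<forall>\<^sub>F n in sequentially. (\<Sum>i\<in>I (r n). w (r n) i * infdist (z (r n) i) (K m)) = 0"
    proof (rule eventually_sequentiallyI[of m])
      fix n assume "m \<le> n"
      then have "m \<le> r n" using seq_suble[OF r, of n] by simp
      then have "z (r n) i \<in> K m" if "i \<in> I (r n)" for i using z[OF that] decseqD[OF K(2)] by blast
      then show "(\<Sum>i\<in>I (r n). w (r n) i * infdist (z (r n) i) (K m)) = 0" by simp
    qed
    then have "(\<lambda>n. \<Sum>i\<in>I (r n). w (r n) i * infdist (z (r n) i) (K m)) \<longlonglongrightarrow> 0"
      by (rule tendsto_eventually)
    with lim[OF c] have "(\<integral>v. infdist v (K m) \<partial>\<theta>) = 0" by (meson LIMSEQ_unique)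
    then have "AE v in \<theta>. infdist v (K m) = 0"
      using integral_nonneg_eq_0_iff_AE[of \<theta> "\<lambda>v. infdist v (K m)"] lim[OF c] infdist_nonneg by auto
    then show ?thesis
      using in_closed_iff_infdist_zero[OF K(1) \<open>K m \<noteq> {}\<close>] by simp
  qed
  then have S: "AE v in \<theta>. v \<in> (\<Inter>n. K n)" by (simp add: AE_all_countable)
  have "continuous_on UNIV (\<lambda>v::real \<times> real \<times> real. snd (snd v))" by (intro continuous_intros)
  from lim[OF this] have l1: "(\<lambda>n. \<Sum>i\<in>I (r n). w (r n) i * snd (snd (z (r n) i))) \<longlonglongrightarrow> (\<integral>v. snd (snd v) \<partial>\<theta>)" ..
  have l2: "(\<lambda>n. L - 2 / real (Suc (r n))) \<longlonglongrightarrow> L - 0"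
    by (intro tendsto_diff tendsto_const small)
  have "L - 0 \<le> (\<integral>v. snd (snd v) \<partial>\<theta>)"
    by (rule LIMSEQ_le[OF l2 l1]) (use gain in blast)
  then have "L \<le> (\<integral>v. snd (snd v) \<partial>\<theta>)" by simp
  show ?thesis by (rule that[OF \<theta> S]) (fact A, fact B, fact)
qed

text \<open>Having no cover of cost at most \<open>L\<close> is a property monotone in the set and
  continuous along increasing unions. Capacity approximation therefore yields closed sets with the
  same property whose intersection lies in \<open>E\<close>.\<close>

lemma unit_interval_transport:
  fixes \<mu> \<nu> :: "real measure"
  assumes \<mu>: "prob_space \<mu>" "sets \<mu> = sets borel" "AE x in \<mu>. x \<in> {0..1}"
    and \<nu>: "prob_space \<nu>" "sets \<nu> = sets borel" "AE y in \<nu>. y \<in> {0..1}"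
    and E: "E \<in> sets borel" "E \<subseteq> {0..1} \<times> {0..1} \<times> {0..1}" "cover_pairs \<mu> \<nu> E L = {}"
    and L: "0 \<le> L"
  obtains \<theta> where "sets \<theta> = sets borel" "finite_measure \<theta>" "AE v in \<theta>. v \<in> E"
    "\<And>A. A \<in> sets borel \<Longrightarrow> emeasure (distr \<theta> borel fst) A \<le> emeasure \<mu> A"
    "\<And>B. B \<in> sets borel \<Longrightarrow> emeasure (distr \<theta> borel (\<lambda>v. fst (snd v))) B \<le> emeasure \<nu> B"
    "L \<le> (\<integral>v. snd (snd v) \<partial>\<theta>)"
proof -
  obtain K :: "nat \<Rightarrow> (real \<times> real \<times> real) set" where K: "\<And>n. closed (K n)" "decseq K"
    "\<And>n. cover_pairs \<mu> \<nu> (K n) L = {}" "(\<Inter>n. K n) \<subseteq> E" "\<And>n. K n \<subseteq> closure E"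
  proof (rule capacity_approximation[of "\<lambda>A. cover_pairs \<mu> \<nu> A L = {}" E])
    show "cover_pairs \<mu> \<nu> B L = {}" if "A \<subseteq> B" "cover_pairs \<mu> \<nu> A L = {}" for A B
      using that unfolding cover_pairs_def by fast
    show "\<exists>n. cover_pairs \<mu> \<nu> (A n) L = {}" if "incseq A" "cover_pairs \<mu> \<nu> (\<Union>n. A n) L = {}" for A :: "nat \<Rightarrow> _"
      using cover_pairs_UN[OF \<mu>(1) \<nu>(1) that(1)] that(2) by blast
  qed (use E in auto)
  have "closure E \<subseteq> {0..1} \<times> {0..1} \<times> {0..1}"
    using E(2) by (intro closure_minimal closed_Times) auto
  then have cube: "K n \<subseteq> {0..1} \<times> {0..1} \<times> {0..1}" for n using K(5) by blast
  obtain \<theta> where \<theta>: "sets \<theta> = sets borel" "finite_measure \<theta>" "AE v in \<theta>. v \<in> (\<Inter>n. K n)"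
    and rest: "\<And>A. A \<in> sets borel \<Longrightarrow> emeasure (distr \<theta> borel fst) A \<le> emeasure \<mu> A"
      "\<And>B. B \<in> sets borel \<Longrightarrow> emeasure (distr \<theta> borel (\<lambda>v. fst (snd v))) B \<le> emeasure \<nu> B"
      "L \<le> (\<integral>v. snd (snd v) \<partial>\<theta>)"
    using compact_transport[OF \<mu> \<nu> K(1,2) cube K(3) L] by blast
  have "AE v in \<theta>. v \<in> E" using \<theta>(3) by eventually_elim (use K(4) in blast)
  then show ?thesis using that[OF \<theta>(1,2) _ rest] by blast
qed

section \<open>Borel coding of Polish spaces in the unit interval\<close>

text \<open>A point is coded by the bits telling which points \<open>d j\<close> of a dense sequence
  lie within \<open>1 / (n + 1)\<close> of it. Decoding takes, for every \<open>n\<close>, the first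
  such \<open>j\<close> and passes to the limit; completeness makes the limit exist whenever the
  sequence is Cauchy.\<close>

lemma polish_borel_retract_of_real:
  obtains code :: "'a::polish_space \<Rightarrow> real" and dec :: "real \<Rightarrow> 'a"
  where "code \<in> borel_measurable borel" "dec \<in> borel_measurable borel"
    "\<And>x. code x \<in> {0..1}" "\<And>x. dec (code x) = x"
proof -
  obtain D :: "'a set" where D: "countable D" "\<And>X. open X \<Longrightarrow> X \<noteq> {} \<Longrightarrow> \<exists>d\<in>D. d \<in> X"
    using countable_dense_exists by blast
  have "D \<noteq> {}" using D(2)[of UNIV] by auto
  define d where "d = from_nat_into D"
  have dense: "\<exists>j. dist x (d j) < e" if "0 < e" for x e
  proof -
    have "x \<in> ball x e" using that by simp
    then obtain y where "y \<in> D" "y \<in> ball x e" using D(2)[OF open_ball, of x e] by blast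
    moreover obtain j where "d j = y" using from_nat_into_surj[OF D(1) \<open>y \<in> D\<close>] by (auto simp: d_def)
    ultimately show ?thesis by auto
  qed
  define b where "b x i = (case prod_decode i of (n, j) \<Rightarrow> dist x (d j) < inverse (real (Suc n)))" for x i
  define code where "code x = ternary (b x)" for x
  \<comment> \<open>On a code the function \<open>schoenberg\<close> returns exactly 0 or 1, so the
    threshold \<open>1 / 2\<close> reads the bit.\<close>
  define k where "k n r = (LEAST j. 1 / 2 < schoenberg (3 ^ prod_encode (n, j) * r))" for n r
  define u where "u n r = d (k n r)" for n r
  \<comment> \<open>An arbitrary real may decode to a divergent sequence. The constant
    \<open>d 0\<close> then replaces it, so that \<open>dec\<close> is a pointwise limit of
    measurable functions everywhere.\<close>
  define v where "v n r = (if Cauchy (\<lambda>n. u n r) then u n r else d 0)" for n r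
  define dec where "dec r = lim (\<lambda>n. v n r)" for r
  have "(\<lambda>x. of_bool (b x i) :: real) \<in> borel_measurable borel" for i
    unfolding b_def by (cases "prod_decode i") simp
  then have code_m: "code \<in> borel_measurable borel"
    unfolding code_def ternary_def by (intro borel_measurable_suminf borel_measurable_divide borel_measurable_times) auto
  have [measurable]: "schoenberg \<in> borel_measurable borel"
    by (intro borel_measurable_continuous_onI schoenberg_continuous)
  have [measurable]: "k n \<in> borel \<rightarrow>\<^sub>M count_space UNIV" for n unfolding k_def by measurable
  have [measurable]: "u n \<in> borel_measurable borel" for n
    unfolding u_def by (rule measurable_compose[of "k n" _ "count_space UNIV"]) auto
  have [measurable]: "Measurable.pred borel (\<lambda>r. Cauchy (\<lambda>n. u n r))"
    using sets_Collect_Cauchy[of u borel] by (simp add: pred_def)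
  have vm: "v n \<in> borel_measurable borel" for n unfolding v_def by measurable
  have "(\<lambda>n. v n r) \<longlonglongrightarrow> dec r" for r
  proof -
    have "Cauchy (\<lambda>n. v n r)" unfolding v_def by (cases "Cauchy (\<lambda>n. u n r)") (simp_all add: convergent_Cauchy convergent_const)
    then show ?thesis unfolding dec_def by (simp add: Cauchy_convergent_iff convergent_LIMSEQ_iff)
  qed
  note lim_v = this
  have dec_m: "dec \<in> borel_measurable borel"
    by (rule borel_measurable_LIMSEQ_metric[OF vm lim_v])
  have "dec (code x) = x" for x
  proof -
    have near: "dist x (u n (code x)) < inverse (real (Suc n))" for n
    proof -
      have iff: "1 / 2 < schoenberg (3 ^ prod_encode (n, j) * code x) \<longleftrightarrow> dist x (d j) < inverse (real (Suc n))" for j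
        unfolding code_def schoenberg_ternary by (simp add: b_def)
      have "\<exists>j. dist x (d j) < inverse (real (Suc n))" by (intro dense) simp
      then show ?thesis unfolding u_def k_def iff by (rule LeastI_ex)
    qed
    have lim: "(\<lambda>n. u n (code x)) \<longlonglongrightarrow> x"
      unfolding tendsto_dist_iff[of _ x]
      by (rule tendsto_sandwich[OF _ _ tendsto_const LIMSEQ_inverse_real_of_nat])
        (auto intro!: always_eventually less_imp_le near simp: dist_commute simp del: of_nat_Suc)
    then have "(\<lambda>n. v n (code x)) \<longlonglongrightarrow> x"
      using LIMSEQ_imp_Cauchy[OF lim] by (simp add: v_def)
    then show ?thesis using lim_v LIMSEQ_unique by blast
  qed
  then show ?thesis using that[OF code_m dec_m] ternary_bounds by (simp add: code_def)
qed

subsection \<open>Bounded gains on Polish spaces\<close>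

lemma borel_measurable_prod_fst: "fst \<in> borel_measurable (borel :: ('a::topological_space \<times> 'b::topological_space) measure)"
  and borel_measurable_prod_snd: "snd \<in> borel_measurable (borel :: ('a \<times> 'b) measure)"
  by (intro borel_measurable_continuous_onI continuous_intros)+

text \<open>Absence of a duality gap, phrased as an alternative at level \<open>L\<close>: a cover
  of cost at most \<open>L\<close>, or a plan gaining at least \<open>L\<close>. Potentials are
  pulled back along the codes and plans pushed forward along the decoders, which undo the
  codes.\<close>

lemma bounded_transport_duality:
  fixes \<mu> :: "'a::polish_space measure" and \<nu> :: "'b::polish_space measure" and h :: "'a \<times> 'b \<Rightarrow> real"
  assumes \<mu>: "prob_space \<mu>" "sets \<mu> = sets borel" and \<nu>: "prob_space \<nu>" "sets \<nu> = sets borel"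
    and h[measurable]: "h \<in> borel_measurable borel" and h01: "\<And>z. h z \<in> {0..1}" and L: "0 \<le> L"
  obtains (dual) \<phi> \<psi> where "\<phi> \<in> borel_measurable borel" "\<psi> \<in> borel_measurable borel"
      "\<And>x. \<phi> x \<in> {0..1}" "\<And>y. \<psi> y \<in> {0..1}" "\<And>x y. h (x, y) \<le> \<phi> x + \<psi> y"
      "integral\<^sup>L \<mu> \<phi> + integral\<^sup>L \<nu> \<psi> \<le> L"
    | (primal) \<pi> where "sets \<pi> = sets borel" "finite_measure \<pi>"
      "\<And>A. A \<in> sets borel \<Longrightarrow> emeasure (distr \<pi> borel fst) A \<le> emeasure \<mu> A"
      "\<And>B. B \<in> sets borel \<Longrightarrow> emeasure (distr \<pi> borel snd) B \<le> emeasure \<nu> B"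
      "L \<le> integral\<^sup>L \<pi> h"
proof -
  interpret \<mu>: prob_space \<mu> by fact
  interpret \<nu>: prob_space \<nu> by fact
  note [measurable_cong] = \<mu>(2) \<nu>(2)
  note [measurable] = borel_measurable_prod_fst borel_measurable_prod_snd
  obtain cX :: "'a \<Rightarrow> real" and dX where cX[measurable]: "cX \<in> borel_measurable borel"
    and dX[measurable]: "dX \<in> borel_measurable borel" and X: "\<And>x. cX x \<in> {0..1}" "\<And>x. dX (cX x) = x"
    by (rule polish_borel_retract_of_real) blast
  obtain cY :: "'b \<Rightarrow> real" and dY where cY[measurable]: "cY \<in> borel_measurable borel"
    and dY[measurable]: "dY \<in> borel_measurable borel" and Y: "\<And>y. cY y \<in> {0..1}" "\<And>y. dY (cY y) = y"
    by (rule polish_borel_retract_of_real) blast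
  define \<mu>' where "\<mu>' = distr \<mu> borel cX"
  define \<nu>' where "\<nu>' = distr \<nu> borel cY"
  have \<mu>': "prob_space \<mu>'" "sets \<mu>' = sets borel" "AE x in \<mu>'. x \<in> {0..1}"
    unfolding \<mu>'_def using X(1) by (auto intro!: \<mu>.prob_space_distr simp: AE_distr_iff)
  have \<nu>': "prob_space \<nu>'" "sets \<nu>' = sets borel" "AE x in \<nu>'. x \<in> {0..1}"
    unfolding \<nu>'_def using Y(1) by (auto intro!: \<nu>.prob_space_distr simp: AE_distr_iff)
  \<comment> \<open>The hypograph is expressed through the decoders and is thus visibly Borel; it
    contains the coded graph of \<open>h\<close>.\<close>
  define E where "E = {v \<in> {0..1} \<times> {0..1} \<times> {0..1}. snd (snd v) \<le> h (dX (fst v), dY (fst (snd v)))}"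
  have "E = {v \<in> space borel. fst v \<in> {0..1} \<and> fst (snd v) \<in> {0..1} \<and> snd (snd v) \<in> {0..1} \<and>
      snd (snd v) \<le> h (dX (fst v), dY (fst (snd v)))}" by (auto simp: E_def)
  also have "\<dots> \<in> sets borel" by measurable
  finally have E: "E \<in> sets borel" .
  have E01: "E \<subseteq> {0..1} \<times> {0..1} \<times> {0..1}" by (auto simp: E_def)
  show ?thesis
  proof (cases "cover_pairs \<mu>' \<nu>' E L = {}")
    case False
    then obtain \<phi> \<psi> where c: "(\<phi>, \<psi>) \<in> cover_pairs \<mu>' \<nu>' E L" by auto
    then have [measurable]: "\<phi> \<in> borel_measurable borel" "\<psi> \<in> borel_measurable borel"
      by (auto simp: cover_pairs_def \<mu>'_def \<nu>'_def)
    show ?thesis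
    proof (rule dual[of "\<lambda>x. \<phi> (cX x)" "\<lambda>y. \<psi> (cY y)"])
      show "h (x, y) \<le> \<phi> (cX x) + \<psi> (cY y)" for x y
      proof -
        have "(cX x, cY y, h (x, y)) \<in> E" using X Y h01 by (auto simp: E_def)
        then show ?thesis using c by (auto simp: cover_pairs_def)
      qed
      show "(\<integral>x. \<phi> (cX x) \<partial>\<mu>) + (\<integral>y. \<psi> (cY y) \<partial>\<nu>) \<le> L"
        using c by (simp add: cover_pairs_def \<mu>'_def \<nu>'_def integral_distr)
    qed (use c in \<open>auto simp: cover_pairs_def\<close>)
  next
    case True
    obtain \<theta> where \<theta>: "sets \<theta> = sets borel" "finite_measure \<theta>" "AE v in \<theta>. v \<in> E"
      and mA: "\<And>A. A \<in> sets borel \<Longrightarrow> emeasure (distr \<theta> borel fst) A \<le> emeasure \<mu>' A"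
      and mB: "\<And>B. B \<in> sets borel \<Longrightarrow> emeasure (distr \<theta> borel (\<lambda>v. fst (snd v))) B \<le> emeasure \<nu>' B"
      and val: "L \<le> (\<integral>v. snd (snd v) \<partial>\<theta>)"
      using unit_interval_transport[OF \<mu>' \<nu>' E E01 True L] by blast
    interpret \<theta>: finite_measure \<theta> by fact
    note [measurable_cong] = \<theta>(1)
    define g where "g v = (dX (fst v), dY (fst (snd v)))" for v :: "real \<times> real \<times> real"
    have [measurable]: "g \<in> borel_measurable borel" unfolding g_def by measurable
    define \<pi> where "\<pi> = distr \<theta> borel g"
    have fin: "finite_measure \<pi>" unfolding \<pi>_def by (rule \<theta>.finite_measure_distr) simp
    have sets_\<pi>: "sets \<pi> = sets borel" by (simp add: \<pi>_def)
    have A: "emeasure (distr \<pi> borel fst) A \<le> emeasure \<mu> A" if [measurable]: "A \<in> sets borel" for A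
    proof -
      have "distr \<pi> borel fst = distr (distr \<theta> borel fst) borel dX"
        unfolding \<pi>_def by (simp add: distr_distr comp_def g_def)
      then have "emeasure (distr \<pi> borel fst) A = emeasure (distr \<theta> borel fst) (dX -` A)"
        by (simp add: emeasure_distr)
      also have "\<dots> \<le> emeasure \<mu>' (dX -` A)"
        using measurable_sets[OF dX that] by (intro mA) simp
      also have "\<dots> = emeasure (distr \<mu>' borel dX) A"
        using measurable_sets[OF dX that] by (simp add: \<mu>'_def emeasure_distr)
      also have "distr \<mu>' borel dX = distr \<mu> borel (\<lambda>x. x)"
        unfolding \<mu>'_def by (simp add: distr_distr comp_def X)
      also have "\<dots> = \<mu>" by (rule distr_id2[OF \<mu>(2)[symmetric]])
      finally show ?thesis .
    qed
    have B: "emeasure (distr \<pi> borel snd) A \<le> emeasure \<nu> A" if [measurable]: "A \<in> sets borel" for A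
    proof -
      have "distr \<pi> borel snd = distr (distr \<theta> borel (\<lambda>v. fst (snd v))) borel dY"
        unfolding \<pi>_def by (simp add: distr_distr comp_def g_def)
      then have "emeasure (distr \<pi> borel snd) A = emeasure (distr \<theta> borel (\<lambda>v. fst (snd v))) (dY -` A)"
        by (simp add: emeasure_distr)
      also have "\<dots> \<le> emeasure \<nu>' (dY -` A)"
        using measurable_sets[OF dY that] by (intro mB) simp
      also have "\<dots> = emeasure (distr \<nu>' borel dY) A"
        using measurable_sets[OF dY that] by (simp add: \<nu>'_def emeasure_distr)
      also have "distr \<nu>' borel dY = distr \<nu> borel (\<lambda>x. x)"
        unfolding \<nu>'_def by (simp add: distr_distr comp_def Y)
      also have "\<dots> = \<nu>" by (rule distr_id2[OF \<nu>(2)[symmetric]])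
      finally show ?thesis .
    qed
    have "(\<integral>v. snd (snd v) \<partial>\<theta>) \<le> (\<integral>v. h (g v) \<partial>\<theta>)"
    proof (rule integral_mono_AE)
      show "integrable \<theta> (\<lambda>v. snd (snd v))"
        using \<theta>(3) by (intro \<theta>.integrable_const_bound[where B = 1]) (auto simp: E_def elim: eventually_mono)
      show "integrable \<theta> (\<lambda>v. h (g v))"
        using h01 by (intro \<theta>.integrable_const_bound[where B = 1]) auto
      show "AE v in \<theta>. snd (snd v) \<le> h (g v)"
        using \<theta>(3) by (rule eventually_mono) (simp add: E_def g_def)
    qed
    also have "\<dots> = integral\<^sup>L \<pi> h" by (simp add: \<pi>_def integral_distr)
    finally have "L \<le> integral\<^sup>L \<pi> h" using val by simp
    then show ?thesis by (intro primal[of \<pi>] sets_\<pi> fin A B)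
  qed
qed

section \<open>Upper bound of the relaxed transport cost by the dual value\<close>

text \<open>The alternative is applied to the gain \<open>1 - min c M / M\<close> at level
  \<open>1 - e\<close>. A cheap cover would give dual potentials of value above the supremum, so a
  plan of gain at least \<open>1 - e\<close> exists.\<close>

lemma P_eps_le_D_dual:
  fixes \<mu> :: "'a::polish_space measure" and \<nu> :: "'b::polish_space measure"
    and c :: "'a \<times> 'b \<Rightarrow> ennreal"
  assumes \<mu>: "prob_space \<mu>" "sets \<mu> = sets borel" and \<nu>: "prob_space \<nu>" "sets \<nu> = sets borel"
    and c[measurable]: "c \<in> borel_measurable borel" and \<epsilon>: "0 < \<epsilon>"
  shows "enn2ereal (P_eps \<mu> \<nu> c \<epsilon>) \<le> D_dual \<mu> \<nu> c"
proof (rule ereal_le_epsilon2)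
  fix \<delta> :: real assume \<delta>: "0 < \<delta>"
  interpret \<mu>: prob_space \<mu> by fact
  interpret \<nu>: prob_space \<nu> by fact
  note [measurable_cong] = \<mu>(2) \<nu>(2)
  note [measurable] = borel_measurable_prod_fst borel_measurable_prod_snd
  \<comment> \<open>The zero potentials are admissible since \<open>c \<ge> 0\<close>; this excludes
    the dual value \<open>-\<infinity>\<close>.\<close>
  have "(\<lambda>_. 0, \<lambda>_. 0) \<in> dual_pairs \<mu> \<nu> c"
    by (simp add: dual_pairs_def ereal_integrable_def)
  then have "ereal (ereal_integral \<mu> (\<lambda>_. 0) + ereal_integral \<nu> (\<lambda>_. 0)) \<le> D_dual \<mu> \<nu> c"
    unfolding D_dual_def by (rule SUP_upper2) simp
  then have D0: "0 \<le> D_dual \<mu> \<nu> c" by (simp add: ereal_integral_def zero_ereal_def)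
  show "enn2ereal (P_eps \<mu> \<nu> c \<epsilon>) \<le> D_dual \<mu> \<nu> c + ereal \<delta>"
  proof (cases "D_dual \<mu> \<nu> c")
    case (real d)
    \<comment> \<open>The cap at 1 keeps the level \<open>1 - e\<close> nonnegative.\<close>
    define e where "e = min \<epsilon> 1"
    have e: "0 < e" "e \<le> 1" "e \<le> \<epsilon>" using \<epsilon> by (auto simp: e_def)
    \<comment> \<open>Chosen so that \<open>M * e = d + \<delta>\<close>: this is the value the dual
      potentials would reach and also the bound on the cost of the plan.\<close>
    define M where "M = (d + \<delta>) / e"
    have d0: "0 \<le> d" using D0 real by simp
    have M: "0 < M" "M * e = d + \<delta>" using d0 \<delta> e by (auto simp: M_def)
    define cM where "cM z = enn2real (min (c z) (ennreal M))" for z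
    have cM: "ennreal (cM z) = min (c z) (ennreal M)" for z
      unfolding cM_def by (intro ennreal_enn2real) (simp add: min_less_iff_disj)
    have cM0: "0 \<le> cM z" for z by (simp add: cM_def)
    have cMM: "cM z \<le> M" for z
    proof -
      have "ennreal (cM z) \<le> ennreal M" by (simp add: cM)
      then show ?thesis using M by (simp add: ennreal_le_iff)
    qed
    have [measurable]: "cM \<in> borel_measurable borel" unfolding cM_def by measurable
    define h where "h z = 1 - cM z / M" for z
    have hM: "cM z = M - M * h z" for z using M(1) by (simp add: h_def algebra_simps)
    have h01: "h z \<in> {0..1}" for z using M(1) cM0[of z] cMM[of z] by (simp add: h_def)
    have [measurable]: "h \<in> borel_measurable borel" unfolding h_def by measurable
    have "h \<in> borel_measurable borel" "0 \<le> 1 - e" using e by auto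
    from \<mu> \<nu> this(1) h01 this(2) show ?thesis
    proof (cases rule: bounded_transport_duality)
      case (dual \<phi> \<psi>)
      note [measurable] = dual(1,2)
      \<comment> \<open>The constant \<open>M\<close> is split evenly, so that
        \<open>\<Phi> x + \<Psi> y = M - M * (\<phi> x + \<psi> y)\<close> stays below the truncated
        cost.\<close>
      define \<Phi> where "\<Phi> x = M / 2 - M * \<phi> x" for x
      define \<Psi> where "\<Psi> y = M / 2 - M * \<psi> y" for y
      have [measurable]: "\<Phi> \<in> borel_measurable borel" "\<Psi> \<in> borel_measurable borel"
        unfolding \<Phi>_def \<Psi>_def by measurable
      have half: "\<bar>M / 2 - M * s\<bar> \<le> M" if "s \<in> {0..1}" for s
      proof -
        have "0 \<le> M * s" "M * s \<le> M" using that M(1) by (auto simp: mult_left_le)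
        then show ?thesis using M(1) unfolding abs_le_iff by linarith
      qed
      have b: "\<bar>\<Phi> x\<bar> \<le> M" "\<bar>\<Psi> y\<bar> \<le> M" for x y
        unfolding \<Phi>_def \<Psi>_def by (rule half[OF dual(3)], rule half[OF dual(4)])
      have int: "integrable \<mu> \<phi>" "integrable \<nu> \<psi>"
        using dual(3,4) by (auto intro!: \<mu>.integrable_const_bound[where B = 1] \<nu>.integrable_const_bound[where B = 1])
      have "(\<integral>\<^sup>+x. ennreal \<bar>\<Phi> x\<bar> \<partial>\<mu>) \<le> (\<integral>\<^sup>+x. ennreal M \<partial>\<mu>)" "(\<integral>\<^sup>+y. ennreal \<bar>\<Psi> y\<bar> \<partial>\<nu>) \<le> (\<integral>\<^sup>+y. ennreal M \<partial>\<nu>)"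
        by (rule nn_integral_mono, rule ennreal_leI, rule b)+
      then have "(\<integral>\<^sup>+x. ennreal \<bar>\<Phi> x\<bar> \<partial>\<mu>) < \<infinity>" "(\<integral>\<^sup>+y. ennreal \<bar>\<Psi> y\<bar> \<partial>\<nu>) < \<infinity>"
        by (auto simp: \<mu>.emeasure_space_1 \<nu>.emeasure_space_1 intro: order_le_less_trans)
      then have "ereal_integrable \<mu> (\<lambda>x. ereal (\<Phi> x))" "ereal_integrable \<nu> (\<lambda>y. ereal (\<Psi> y))"
        by (auto simp: ereal_integrable_def)
      moreover have "ereal (\<Phi> x) + ereal (\<Psi> y) \<le> enn2ereal (c (x, y))" for x y
      proof -
        have "\<Phi> x + \<Psi> y = M - M * (\<phi> x + \<psi> y)" by (simp add: \<Phi>_def \<Psi>_def algebra_simps)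
        also have "\<dots> \<le> cM (x, y)" unfolding hM using dual(5)[of x y] M(1) by simp
        finally have "ereal (\<Phi> x + \<Psi> y) \<le> ereal (cM (x, y))" by simp
        also have "\<dots> = enn2ereal (min (c (x, y)) (ennreal M))"
          using cM0 by (simp add: enn2ereal_ennreal flip: cM)
        also have "\<dots> \<le> enn2ereal (c (x, y))" by (simp flip: less_eq_ennreal.rep_eq)
        finally show ?thesis by simp
      qed
      ultimately have "(\<lambda>x. ereal (\<Phi> x), \<lambda>y. ereal (\<Psi> y)) \<in> dual_pairs \<mu> \<nu> c"
        by (simp add: dual_pairs_def)
      then have "ereal (integral\<^sup>L \<mu> \<Phi> + integral\<^sup>L \<nu> \<Psi>) \<le> D_dual \<mu> \<nu> c"
        unfolding D_dual_def by (rule SUP_upper2) (simp add: ereal_integral_def)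
      then have "integral\<^sup>L \<mu> \<Phi> + integral\<^sup>L \<nu> \<Psi> \<le> d" by (simp add: real)
      moreover have "integral\<^sup>L \<mu> \<Phi> + integral\<^sup>L \<nu> \<Psi> = M - M * (integral\<^sup>L \<mu> \<phi> + integral\<^sup>L \<nu> \<psi>)"
        unfolding \<Phi>_def \<Psi>_def using int by (simp add: \<mu>.prob_space \<nu>.prob_space algebra_simps)
      moreover have "M * (integral\<^sup>L \<mu> \<phi> + integral\<^sup>L \<nu> \<psi>) \<le> M * (1 - e)"
        using dual(6) M(1) by (intro mult_left_mono) auto
      ultimately have "d + \<delta> \<le> d" using M(2) by (simp add: algebra_simps)
      then show ?thesis using \<delta> by simp
    next
      case (primal \<pi>)
      interpret \<pi>: finite_measure \<pi> by fact
      note [measurable_cong] = primal(1)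
      have sp: "space \<pi> = UNIV" using sets_eq_imp_space_eq[OF primal(1)] by simp
      \<comment> \<open>Off \<open>S\<close> the gain vanishes, so \<open>\<pi>\<close> gives
        \<open>S\<close> mass at least its gain \<open>1 - e\<close>. On \<open>S\<close> the cost
        is untruncated and equals \<open>M - M * h\<close>.\<close>
      define S where "S = {z. c z < ennreal M}"
      have "{z \<in> space borel. c z < ennreal M} \<in> sets borel" by measurable
      then have S[measurable]: "S \<in> sets borel" by (simp add: S_def)
      define \<pi>' where "\<pi>' = density \<pi> (indicator S)"
      have sets_\<pi>': "sets \<pi>' = sets borel" by (simp add: \<pi>'_def primal(1))
      note [measurable_cong] = sets_\<pi>'
      have em: "emeasure \<pi>' B = emeasure \<pi> (S \<inter> B)" if "B \<in> sets borel" for B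
      proof -
        have "emeasure \<pi>' B = (\<integral>\<^sup>+z. indicator S z * indicator B z \<partial>\<pi>)"
          unfolding \<pi>'_def using that by (subst emeasure_density) (auto simp: primal(1))
        also have "\<dots> = (\<integral>\<^sup>+z. indicator (S \<inter> B) z \<partial>\<pi>)" by (simp only: indicator_inter_arith)
        also have "\<dots> = emeasure \<pi> (S \<inter> B)" using that S by (intro nn_integral_indicator) (auto simp: primal(1))
        finally show ?thesis .
      qed
      have mono: "emeasure (distr \<pi>' borel f) B \<le> emeasure (distr \<pi> borel f) B"
        if [measurable]: "f \<in> borel_measurable borel" and [measurable]: "B \<in> sets borel"
        for f :: "'a \<times> 'b \<Rightarrow> 'z::topological_space" and B
      proof -
        have fB: "f -` B \<in> sets borel" using measurable_sets[OF that] by simp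
        then show ?thesis
          using em[OF fB] sets_eq_imp_space_eq[OF sets_\<pi>'] by (simp add: emeasure_distr sp emeasure_mono primal(1))
      qed
      have "emeasure \<pi> UNIV = emeasure (distr \<pi> borel fst) UNIV" by (simp add: emeasure_distr sp)
      also have "\<dots> \<le> emeasure \<mu> UNIV" by (rule primal(3)) simp
      also have "\<dots> = 1" using \<mu>.emeasure_space_1 sets_eq_imp_space_eq[OF \<mu>(2)] by simp
      finally have "emeasure \<pi> UNIV \<le> 1" .
      then have m1: "measure \<pi> S \<le> 1"
        using \<pi>.finite_measure_mono[of S UNIV] primal(1) by (simp add: \<pi>.emeasure_eq_measure)
      have hS: "h z = 0" if "z \<notin> S" for z
        using that M(1) by (simp add: S_def h_def cM_def min_absorb2)
      have intS: "integrable \<pi> (indicator S :: _ \<Rightarrow> real)"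
        by (intro integrable_real_indicator) (auto simp: primal(1) \<pi>.emeasure_eq_measure)
      have inth: "integrable \<pi> h" using h01 by (intro \<pi>.integrable_const_bound[where B = 1]) auto
      have "integral\<^sup>L \<pi> h \<le> integral\<^sup>L \<pi> (indicator S)"
        using h01 hS by (intro integral_mono inth intS) (auto simp: indicator_def)
      then have mS: "1 - e \<le> measure \<pi> S" using primal(5) by (simp add: sp)
      have "emeasure \<pi>' (space \<pi>') = ennreal (measure \<pi> S)"
        using em[of UNIV] sets_eq_imp_space_eq[OF sets_\<pi>'] by (simp add: \<pi>.emeasure_eq_measure)
      moreover have "ennreal (1 - \<epsilon>) \<le> ennreal (measure \<pi> S)" using mS e(3) by (intro ennreal_leI) simp
      ultimately have "\<pi>' \<in> partial_couplings \<mu> \<nu> \<epsilon>"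
        unfolding partial_couplings_def using primal(3,4) sets_\<pi>'
        by (auto intro: order_trans[OF mono] borel_measurable_prod_fst borel_measurable_prod_snd)
      then have "P_eps \<mu> \<nu> c \<epsilon> \<le> (\<integral>\<^sup>+z. c z \<partial>\<pi>')"
        unfolding P_eps_def by (rule INF_lower)
      also have "\<dots> = (\<integral>\<^sup>+z. indicator S z * c z \<partial>\<pi>)"
        unfolding \<pi>'_def by (rule nn_integral_density) (auto simp: primal(1))
      also have "\<dots> = (\<integral>\<^sup>+z. ennreal (M * indicator S z - M * h z) \<partial>\<pi>)"
      proof (rule nn_integral_cong)
        fix z
        show "indicator S z * c z = ennreal (M * indicator S z - M * h z)"
        proof (cases "z \<in> S")
          case True
          then have "c z = ennreal (cM z)" by (simp add: cM S_def min_absorb1 less_imp_le)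
          then show ?thesis using True by (simp add: hM)
        qed (simp add: hS)
      qed
      also have "\<dots> = ennreal (\<integral>z. M * indicator S z - M * h z \<partial>\<pi>)"
      proof (rule nn_integral_eq_integral)
        show "AE z in \<pi>. 0 \<le> M * indicator S z - M * h z"
          using h01 hS M(1) by (intro AE_I2) (auto simp: indicator_def mult_left_le)
      qed (use intS inth in simp)
      also have "(\<integral>z. M * indicator S z - M * h z \<partial>\<pi>) = M * measure \<pi> S - M * integral\<^sup>L \<pi> h"
        using intS inth by (simp add: sp)
      also have "ennreal \<dots> \<le> ennreal (d + \<delta>)"
      \<comment> \<open>Mass at most 1 and gain at least \<open>1 - e\<close> bound the cost by
        \<open>M - M * (1 - e) = M * e\<close>.\<close>
      proof (rule ennreal_leI)
        have "M * measure \<pi> S \<le> M * 1" "M * (1 - e) \<le> M * integral\<^sup>L \<pi> h"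
          using m1 primal(5) M(1) by (auto intro!: mult_left_mono)
        then show "M * measure \<pi> S - M * integral\<^sup>L \<pi> h \<le> d + \<delta>" using M(2) by (simp add: algebra_simps)
      qed
      finally have "enn2ereal (P_eps \<mu> \<nu> c \<epsilon>) \<le> enn2ereal (ennreal (d + \<delta>))"
        by (simp only: less_eq_ennreal.rep_eq)
      also have "\<dots> = ereal (d + \<delta>)" using d0 \<delta> by (intro enn2ereal_ennreal) simp
      finally show ?thesis by (simp add: real)
    qed
  qed (use D0 in auto)
qed

subsection \<open>Truncated potentials\<close>

text \<open>The difference \<open>n - min \<phi> n\<close> is nonnegative, with value
  \<open>\<infinity>\<close> where \<open>\<phi> = -\<infinity>\<close>. It can therefore be
  integrated against any dominated marginal; truncating only from above loses nothing in the
  limit.\<close>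

lemma truncated_potential:
  assumes "prob_space M" and \<phi>: "ereal_integrable M \<phi>"
  defines "I \<equiv> \<lambda>n::nat. \<integral>x. min (real_of_ereal (\<phi> x)) (real n) \<partial>M"
  shows "(\<integral>\<^sup>+x. e2ennreal (ereal (real n) - min (\<phi> x) (ereal (real n))) \<partial>M) = ennreal (real n - I n)"
    and "I n \<le> real n" and "I \<longlonglongrightarrow> ereal_integral M \<phi>"
proof -
  interpret prob_space M by fact
  have [measurable]: "\<phi> \<in> borel_measurable M" and fin: "(\<integral>\<^sup>+x. e2ennreal \<bar>\<phi> x\<bar> \<partial>M) < \<infinity>"
    using \<phi> by (auto simp: ereal_integrable_def)
  have "AE x in M. e2ennreal \<bar>\<phi> x\<bar> \<noteq> \<infinity>"
    using fin by (intro nn_integral_PInf_AE) auto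
  then have real: "AE x in M. ereal (real_of_ereal (\<phi> x)) = \<phi> x"
  proof eventually_elim
    case (elim x)
    then show ?case by (cases "\<phi> x") auto
  qed
  have "(\<integral>\<^sup>+x. ennreal (norm (real_of_ereal (\<phi> x))) \<partial>M) \<le> (\<integral>\<^sup>+x. e2ennreal \<bar>\<phi> x\<bar> \<partial>M)"
  proof (rule nn_integral_mono)
    show "ennreal (norm (real_of_ereal (\<phi> x))) \<le> e2ennreal \<bar>\<phi> x\<bar>" for x by (cases "\<phi> x") auto
  qed
  then have int: "integrable M (\<lambda>x. real_of_ereal (\<phi> x))"
    using fin by (intro integrableI_bounded) auto
  have intn: "integrable M (\<lambda>x. min (real_of_ereal (\<phi> x)) (real n))" for n :: nat
    using int by (intro integrable_min) auto
  have "(\<integral>\<^sup>+x. e2ennreal (ereal (real n) - min (\<phi> x) (ereal (real n))) \<partial>M)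
      = (\<integral>\<^sup>+x. ennreal (real n - min (real_of_ereal (\<phi> x)) (real n)) \<partial>M)"
  proof (rule nn_integral_cong_AE)
    show "AE x in M. e2ennreal (ereal (real n) - min (\<phi> x) (ereal (real n)))
        = ennreal (real n - min (real_of_ereal (\<phi> x)) (real n))"
      using real
    proof eventually_elim
      case (elim x)
      then obtain a where "\<phi> x = ereal a" by metis
      then show ?case by (simp flip: ereal_min)
    qed
  qed
  also have "\<dots> = ennreal (\<integral>x. real n - min (real_of_ereal (\<phi> x)) (real n) \<partial>M)"
    using intn by (intro nn_integral_eq_integral) auto
  also have "(\<integral>x. real n - min (real_of_ereal (\<phi> x)) (real n) \<partial>M) = real n - I n"
    using intn by (simp add: I_def prob_space)
  finally show "(\<integral>\<^sup>+x. e2ennreal (ereal (real n) - min (\<phi> x) (ereal (real n))) \<partial>M) = ennreal (real n - I n)" .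
  have "I n \<le> (\<integral>x. real n \<partial>M)" unfolding I_def using intn by (intro integral_mono) auto
  then show "I n \<le> real n" by (simp add: prob_space)
  show "I \<longlonglongrightarrow> ereal_integral M \<phi>"
    unfolding I_def ereal_integral_def
  proof (rule integral_dominated_convergence[where w = "\<lambda>x. \<bar>real_of_ereal (\<phi> x)\<bar>"])
    show "AE x in M. (\<lambda>n. min (real_of_ereal (\<phi> x)) (real n)) \<longlonglongrightarrow> real_of_ereal (\<phi> x)"
    proof (rule AE_I2)
      fix x
      obtain N where N: "real_of_ereal (\<phi> x) \<le> real N" using real_arch_simple by blast
      have "min (real_of_ereal (\<phi> x)) (real n) = real_of_ereal (\<phi> x)" if "N \<le> n" for n
        using N that by (simp add: min_absorb1 order_trans[OF N])
      then show "(\<lambda>n. min (real_of_ereal (\<phi> x)) (real n)) \<longlonglongrightarrow> real_of_ereal (\<phi> x)"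
        by (intro tendsto_eventually) (auto simp: eventually_sequentially)
    qed
    show "integrable M (\<lambda>x. \<bar>real_of_ereal (\<phi> x)\<bar>)" using int by (rule integrable_abs)
    have "\<bar>min a (real n)\<bar> \<le> \<bar>a\<bar>" for a n by (auto simp: min_def)
    then show "AE x in M. norm (min (real_of_ereal (\<phi> x)) (real n)) \<le> \<bar>real_of_ereal (\<phi> x)\<bar>" for n
      unfolding real_norm_def by (intro AE_I2)
  qed auto
qed

lemma nn_integral_marginal_le:
  assumes \<pi>: "sets \<pi> = sets borel" and f: "f \<in> borel_measurable borel" and M: "sets M = sets borel"
    and le: "\<And>A. A \<in> sets borel \<Longrightarrow> emeasure (distr \<pi> borel f) A \<le> emeasure M A"
    and g: "g \<in> borel_measurable borel"
  shows "(\<integral>\<^sup>+z. g (f z) \<partial>\<pi>) \<le> integral\<^sup>N M g"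
proof -
  note [measurable_cong] = \<pi>
  note [measurable] = f g
  \<comment> \<open>Nonmeasurable sets have \<open>emeasure\<close> 0 by convention, so the
    comparison extends to all sets, as the order on measures with equal sigma-algebras
    requires.\<close>
  have "emeasure (distr \<pi> borel f) A \<le> emeasure M A" for A
    using le[of A] by (cases "A \<in> sets borel") (simp_all add: emeasure_notin_sets)
  then have "distr \<pi> borel f \<le> M"
    using M sets_eq_imp_space_eq[OF M] by (simp add: le_measure_iff le_fun_def)
  then have "integral\<^sup>N (distr \<pi> borel f) g \<le> integral\<^sup>N M g"
    using M by (intro nn_integral_mono_measure) auto
  then show ?thesis by (simp add: nn_integral_distr)
qed

lemma ennreal_plus3: "0 \<le> a \<Longrightarrow> 0 \<le> b \<Longrightarrow> 0 \<le> c \<Longrightarrow> ennreal (a + b + c) = ennreal a + ennreal b + ennreal c"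
  by simp

text \<open>The inequality \<open>min a n + min b n \<le> C\<close>, rearranged so that all terms
  are nonnegative. An infinite cost or a potential equal to \<open>-\<infinity>\<close> then makes
  the right-hand side infinite.\<close>

lemma potential_sum_le_cost:
  assumes "a + b \<le> enn2ereal C" "a < \<infinity>" "b < \<infinity>"
  shows "ennreal (2 * real n) \<le> C + e2ennreal (ereal (real n) - min a (ereal (real n)))
     + e2ennreal (ereal (real n) - min b (ereal (real n)))"
proof (cases "C = top \<or> a = -\<infinity> \<or> b = -\<infinity>")
  case True
  then show ?thesis by auto
next
  case False
  then obtain x y r where x: "a = ereal x" and y: "b = ereal y" and r: "0 \<le> r" "C = ennreal r"
    using assms(2,3) by (cases a; cases b; cases C) auto
  have "ennreal (2 * real n) \<le> ennreal (r + (real n - min x (real n)) + (real n - min y (real n)))"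
    using assms(1) r by (intro ennreal_leI) (auto simp: x y enn2ereal_ennreal)
  also have "\<dots> = C + ennreal (real n - min x (real n)) + ennreal (real n - min y (real n))"
    unfolding r(2) using r(1) by (intro ennreal_plus3) auto
  finally show ?thesis by (simp add: x y flip: ereal_min)
qed

section \<open>Lower bound of the relaxed transport cost by truncated potentials\<close>

text \<open>Integrating the rearranged constraint against a partial coupling gives at least
  \<open>2 * n * (1 - \<epsilon>)\<close> on the left. On the right, domination of the marginals
  bounds the nonnegative defects \<open>n - min \<phi> n\<close> and \<open>n - min \<psi> n\<close>
  by their integrals under \<open>\<mu>\<close> and \<open>\<nu>\<close>.\<close>

lemma P_eps_ge_truncated_potentials:
  fixes \<mu> :: "'a::polish_space measure" and \<nu> :: "'b::polish_space measure"
  assumes \<mu>: "prob_space \<mu>" "sets \<mu> = sets borel" and \<nu>: "prob_space \<nu>" "sets \<nu> = sets borel"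
    and c: "c \<in> borel_measurable borel"
    and \<phi>: "ereal_integrable \<mu> \<phi>" and \<psi>: "ereal_integrable \<nu> \<psi>"
    and dual: "\<And>x y. \<phi> x + \<psi> y \<le> enn2ereal (c (x, y))" and \<epsilon>: "0 \<le> \<epsilon>" "\<epsilon> \<le> 1"
  shows "ereal ((\<integral>x. min (real_of_ereal (\<phi> x)) (real n) \<partial>\<mu>) + (\<integral>y. min (real_of_ereal (\<psi> y)) (real n) \<partial>\<nu>)
      - 2 * real n * \<epsilon>) \<le> enn2ereal (P_eps \<mu> \<nu> c \<epsilon>)"
proof -
  define I where "I = (\<integral>x. min (real_of_ereal (\<phi> x)) (real n) \<partial>\<mu>)"
  define J where "J = (\<integral>y. min (real_of_ereal (\<psi> y)) (real n) \<partial>\<nu>)"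
  \<comment> \<open>\<open>e2ennreal\<close> sends negative values to 0, which is still a lower
    bound for a nonnegative cost.\<close>
  have "e2ennreal (ereal (I + J - 2 * real n * \<epsilon>)) \<le> P_eps \<mu> \<nu> c \<epsilon>"
    unfolding P_eps_def
  proof (rule INF_greatest)
    fix \<pi> assume \<pi>: "\<pi> \<in> partial_couplings \<mu> \<nu> \<epsilon>"
    then have s: "sets \<pi> = sets borel" and mass: "ennreal (1 - \<epsilon>) \<le> emeasure \<pi> (space \<pi>)"
      and mA: "\<And>A. A \<in> sets borel \<Longrightarrow> emeasure (distr \<pi> borel fst) A \<le> emeasure \<mu> A"
      and mB: "\<And>B. B \<in> sets borel \<Longrightarrow> emeasure (distr \<pi> borel snd) B \<le> emeasure \<nu> B"
      by (auto simp: partial_couplings_def)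
    note [measurable_cong] = s
    have m[measurable]: "fst \<in> borel_measurable (borel :: ('a \<times> 'b) measure)" "snd \<in> borel_measurable (borel :: ('a \<times> 'b) measure)"
      by (intro borel_measurable_continuous_onI continuous_intros)+
    have [measurable]: "\<phi> \<in> borel_measurable borel" "\<psi> \<in> borel_measurable borel" "c \<in> borel_measurable borel"
      using \<phi> \<psi> c \<mu>(2) \<nu>(2) by (auto simp: ereal_integrable_def cong: measurable_cong_sets)
    have less: "\<phi> x < \<infinity>" "\<psi> y < \<infinity>" for x y
      using \<phi> \<psi> sets_eq_imp_space_eq[OF \<mu>(2)] sets_eq_imp_space_eq[OF \<nu>(2)] by (auto simp: ereal_integrable_def)
    define F where "F x = e2ennreal (ereal (real n) - min (\<phi> x) (ereal (real n)))" for x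
    define G where "G y = e2ennreal (ereal (real n) - min (\<psi> y) (ereal (real n)))" for y
    have [measurable]: "F \<in> borel_measurable borel" "G \<in> borel_measurable borel"
      unfolding F_def G_def by measurable
    have "ennreal (2 * real n * (1 - \<epsilon>)) = ennreal (2 * real n) * ennreal (1 - \<epsilon>)"
      using \<epsilon> by (simp add: ennreal_mult)
    also have "\<dots> \<le> ennreal (2 * real n) * emeasure \<pi> (space \<pi>)" by (intro mult_left_mono mass) simp
    also have "\<dots> = (\<integral>\<^sup>+z. ennreal (2 * real n) \<partial>\<pi>)" by simp
    also have "\<dots> \<le> (\<integral>\<^sup>+z. c z + F (fst z) + G (snd z) \<partial>\<pi>)"
    proof (rule nn_integral_mono)
      show "ennreal (2 * real n) \<le> c z + F (fst z) + G (snd z)" for z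
        unfolding F_def G_def using dual[of "fst z" "snd z"] less by (intro potential_sum_le_cost) auto
    qed
    also have "\<dots> = integral\<^sup>N \<pi> c + (\<integral>\<^sup>+z. F (fst z) \<partial>\<pi>) + (\<integral>\<^sup>+z. G (snd z) \<partial>\<pi>)"
      by (simp add: nn_integral_add)
    also have "\<dots> \<le> integral\<^sup>N \<pi> c + integral\<^sup>N \<mu> F + integral\<^sup>N \<nu> G"
      by (intro add_mono order_refl nn_integral_marginal_le s m \<mu>(2) \<nu>(2) mA mB) auto
    also have "integral\<^sup>N \<mu> F = ennreal (real n - I)"
      unfolding F_def I_def by (rule truncated_potential(1)[OF \<mu>(1) \<phi>])
    also have "integral\<^sup>N \<nu> G = ennreal (real n - J)"
      unfolding G_def J_def by (rule truncated_potential(1)[OF \<nu>(1) \<psi>])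
    finally have le: "ennreal (2 * real n * (1 - \<epsilon>)) \<le> integral\<^sup>N \<pi> c + ennreal (real n - I) + ennreal (real n - J)" .
    have IJ: "I \<le> real n" "J \<le> real n"
      unfolding I_def J_def by (rule truncated_potential(2)[OF \<mu>(1) \<phi>], rule truncated_potential(2)[OF \<nu>(1) \<psi>])
    show "e2ennreal (ereal (I + J - 2 * real n * \<epsilon>)) \<le> integral\<^sup>N \<pi> c"
    proof (cases "integral\<^sup>N \<pi> c")
      case (real r)
      then have "ennreal (2 * real n * (1 - \<epsilon>)) \<le> ennreal (r + (real n - I) + (real n - J))"
        using le IJ real by (subst ennreal_plus3) auto
      then have "2 * real n * (1 - \<epsilon>) \<le> r + (real n - I) + (real n - J)"
        using real(1) IJ by (subst (asm) ennreal_le_iff) linarith+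
      then have "I + J - 2 * real n * \<epsilon> \<le> r" by (simp add: algebra_simps)
      then show ?thesis using real by (simp add: ennreal_leI)
    qed simp
  qed
  then have "enn2ereal (e2ennreal (ereal (I + J - 2 * real n * \<epsilon>))) \<le> enn2ereal (P_eps \<mu> \<nu> c \<epsilon>)"
    by (simp add: less_eq_ennreal.rep_eq)
  moreover have "x \<le> enn2ereal (e2ennreal x)" for x
    by (cases "0 \<le> x") (auto simp: enn2ereal_e2ennreal e2ennreal_neg zero_ennreal.rep_eq)
  ultimately show ?thesis unfolding I_def J_def by (rule order_trans[rotated])
qed

section \<open>The limit as the mass defect tends to zero\<close>

theorem theorem1p2:
  fixes \<mu> :: "'a::polish_space measure" and \<nu> :: "'b::polish_space measure"
    and c :: "'a \<times> 'b \<Rightarrow> ennreal"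
  assumes "prob_space \<mu>" and "sets \<mu> = sets borel"
    and "prob_space \<nu>" and "sets \<nu> = sets borel"
    and "c \<in> borel_measurable borel"
  shows "((\<lambda>\<epsilon>. enn2ereal (P_eps \<mu> \<nu> c \<epsilon>)) \<longlongrightarrow> D_dual \<mu> \<nu> c) (at_right 0)"
proof (rule order_tendstoI)
  fix a assume "a > D_dual \<mu> \<nu> c"
  have "\<forall>\<^sub>F \<epsilon>::real in at_right 0. 0 < \<epsilon>" by (rule eventually_at_right_less)
  then show "\<forall>\<^sub>F \<epsilon> in at_right 0. enn2ereal (P_eps \<mu> \<nu> c \<epsilon>) < a"
    by eventually_elim (rule order_le_less_trans[OF P_eps_le_D_dual[OF assms] \<open>a > D_dual \<mu> \<nu> c\<close>])
next
  fix a assume "a < D_dual \<mu> \<nu> c"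
  then obtain \<phi> \<psi> where dual: "(\<phi>, \<psi>) \<in> dual_pairs \<mu> \<nu> c"
    and a: "a < ereal (ereal_integral \<mu> \<phi> + ereal_integral \<nu> \<psi>)"
    unfolding D_dual_def less_SUP_iff by auto
  have \<phi>: "ereal_integrable \<mu> \<phi>" and \<psi>: "ereal_integrable \<nu> \<psi>"
    and le: "\<And>x y. \<phi> x + \<psi> y \<le> enn2ereal (c (x, y))"
    using dual by (auto simp: dual_pairs_def)
  define I where "I n = (\<integral>x. min (real_of_ereal (\<phi> x)) (real n) \<partial>\<mu>)" for n :: nat
  define J where "J n = (\<integral>y. min (real_of_ereal (\<psi> y)) (real n) \<partial>\<nu>)" for n :: nat
  have "(\<lambda>n. ereal (I n + J n)) \<longlonglongrightarrow> ereal (ereal_integral \<mu> \<phi> + ereal_integral \<nu> \<psi>)"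
    unfolding I_def J_def lim_ereal
    by (intro tendsto_add truncated_potential(3)[OF assms(1) \<phi>] truncated_potential(3)[OF assms(3) \<psi>])
  then have "\<forall>\<^sub>F n in sequentially. a < ereal (I n + J n)" using a by (rule order_tendstoD)
  \<comment> \<open>The truncation level is fixed before \<open>\<epsilon>\<close> tends to 0, so
    that the loss \<open>2 * n * \<epsilon>\<close> disappears.\<close>
  then obtain n where n: "a < ereal (I n + J n)" by (auto simp: eventually_sequentially)
  have "((\<lambda>\<epsilon>. ereal (I n + J n - 2 * real n * \<epsilon>)) \<longlongrightarrow> ereal (I n + J n)) (at_right 0)"
    unfolding lim_ereal by (auto intro!: tendsto_eq_intros)
  then have "\<forall>\<^sub>F \<epsilon> in at_right 0. a < ereal (I n + J n - 2 * real n * \<epsilon>)" using n by (rule order_tendstoD)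
  moreover have "\<forall>\<^sub>F \<epsilon> in at_right 0. (0::real) < \<epsilon> \<and> \<epsilon> < 1"
    by (auto simp: eventually_at_right_field intro!: exI[of _ 1])
  ultimately show "\<forall>\<^sub>F \<epsilon> in at_right 0. a < enn2ereal (P_eps \<mu> \<nu> c \<epsilon>)"
  proof eventually_elim
    case (elim \<epsilon>)
    have "ereal (I n + J n - 2 * real n * \<epsilon>) \<le> enn2ereal (P_eps \<mu> \<nu> c \<epsilon>)"
      unfolding I_def J_def using elim by (intro P_eps_ge_truncated_potentials[OF assms \<phi> \<psi> le]) auto
    with elim show ?case by (auto elim: order_less_le_trans)
  qed
qed

end
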